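(* For every prime $p\ge 7$, $$\sum_{j=1}^{p-1}\frac{H_j^{3}}{j}\equiv \frac32\,pB_{p-5}\pmod{p^2}.$$
   Context: For $n\ge 0$, $H_n=\sum_{k=1}^{n}\frac{1}{k}$ is the $n$-th harmonic number. $(B_n)_{n\ge 0}$ is the sequence of Bernoulli numbers. Congruences modulo $p^2$ are between rational numbers whose denominators are prime to $p$. *)

theory Defs
  imports "HOL-Analysis.Analysis" "HOL-Computational_Algebra.Computational_Algebra"
begin

(* The library's harm lives in real normed fields, which excludes the type rat. *)
definition harm_rat :: "nat \<Rightarrow> rat" where
  "harm_rat n = (\<Sum>k=1..n. 1 / of_nat k)"

lemma of_rat_harm_rat: "of_rat (harm_rat n) = (harm n :: real)"
  by (simp add: harm_rat_def harm_def of_rat_sum of_rat_divide inverse_eq_divide)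

(* Exponential generating function X / (exp X - 1), so that bernoulli 1 = - 1 / 2. *)
definition bernoulli :: "nat \<Rightarrow> rat" where
  "bernoulli n = fact n * fps_nth (fps_X / (fps_exp 1 - 1)) n"

lemma bernoulli_fps:
  "Abs_fps (\<lambda>n. bernoulli n / fact n) * (fps_exp 1 - 1) = (fps_X :: rat fps)"
proof -
  let ?E = "fps_exp 1 - 1 :: rat fps"
  have ne: "?E \<noteq> 0"
  proof
    assume "?E = 0"
    then have "fps_nth ?E 1 = 0" by simp
    then show False by simp
  qed
  have sub: "subdegree ?E = 1"
    by (rule subdegreeI) auto
  have "?E dvd fps_X"
    using ne sub by (simp add: fps_dvd_iff)
  then have "fps_X / ?E * ?E = fps_X" by simp
  moreover have "Abs_fps (\<lambda>n. bernoulli n / fact n) = fps_X / ?E"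
    by (rule fps_ext) (simp add: bernoulli_def)
  ultimately show ?thesis by simp
qed

lemma bernoulli_recurrence:
  "(\<Sum>k\<le>n. of_nat (Suc n choose k) * bernoulli k) = (if n = 0 then 1 else 0)"
proof -
  have "(if n = 0 then 1 else 0 :: rat) = fact (Suc n) * fps_nth fps_X (Suc n)"
    by simp
  also have "fps_nth fps_X (Suc n) =
      (\<Sum>k=0..Suc n. bernoulli k / fact k * fps_nth (fps_exp 1 - 1) (Suc n - k))"
    by (simp only: bernoulli_fps[symmetric] fps_mult_nth fps_nth_Abs_fps)
  also have "\<dots> = (\<Sum>k\<le>n. bernoulli k / fact k * (1 / fact (Suc n - k)))"
    by (simp add: atLeast0AtMost sum.atMost_Suc mult.commute)
  also have "fact (Suc n) * \<dots> = (\<Sum>k\<le>n. of_nat (Suc n choose k) * bernoulli k)"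
    unfolding sum_distrib_left
    by (rule sum.cong) (simp_all add: binomial_fact field_simps del: fact_Suc)
  finally show ?thesis by simp
qed

(* quotient_of returns the reduced fraction with positive denominator. *)
definition qcong :: "rat \<Rightarrow> rat \<Rightarrow> int \<Rightarrow> bool" where
  "qcong x y m \<longleftrightarrow>
     coprime (snd (quotient_of x)) m \<and> coprime (snd (quotient_of y)) m \<and>
     m dvd fst (quotient_of (x - y))"

lemma qcong_of_int: "qcong (of_int a) (of_int b) m \<longleftrightarrow> m dvd a - b"
  by (simp add: qcong_def flip: of_int_diff)

end

theory Submission
  imports Defs "HOL-Number_Theory.Residues"
begin

text \<open>
  Write \<open>n = p - 1\<close>, \<open>H_j(a)\<close> for the sum of \<open>1/i^a\<close> over \<open>1 \<le> i \<le> j\<close>, \<open>H_j = H_j(1)\<close>,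
  \<open>D(a,b)\<close> for the sum of \<open>H_j(a)/j^b\<close> over \<open>1 \<le> j \<le> n\<close>, and \<open>B\<close> for the Bernoulli
  number of index \<open>p - 5\<close>. Summing \<open>H_j^4 - H_(j-1)^4\<close> over \<open>j\<close> expresses four times the
  sum of \<open>H_j^3/j\<close> through \<open>H_n^4\<close>, the sum \<open>A\<close> of \<open>H_j^2/j^2\<close>, \<open>D(1,3)\<close> and \<open>H_n(4)\<close>
  (\<open>sum_harm_cube_telescope\<close>). By Wolstenholme's congruence \<open>H_n\<close> vanishes modulo \<open>p^2\<close>, so
  it remains to find the other three quantities modulo \<open>p^2\<close>. Each of them turns out to be a
  multiple of \<open>p B\<close>, and the mechanism is always the same: an exact or approximate symmetry
  determines a sum of weight 4 up to a term \<open>p\<close> times a sum of weight 5, and the latter is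
  needed modulo \<open>p\<close> only.

  For sums of weight 5 modulo \<open>p\<close>, replacing \<open>1/i^a\<close> by \<open>i^(p-1-a)\<close> and applying Faulhaber's formula to the
  inner sum turns \<open>D(a,b)\<close> into a combination of power sums over the residues modulo \<open>p\<close>, of
  which only one is nonzero; it carries \<open>B\<close> (\<open>strict_double_harm_pcong\<close>). This gives
  \<open>D(1,4) = B\<close>, \<open>D(2,3) = -2B\<close> and \<open>D(3,2) = 2B\<close> modulo \<open>p\<close>.

  Two symmetries lift this to weight 4 modulo \<open>p^2\<close>. The first is the reflection
  \<open>j \<mapsto> p - j\<close>, under which \<open>1/j\<close> becomes \<open>-(1/j + p/j^2)\<close>. It maps \<open>D(1,3)\<close> to
  \<open>H_n(4) - D(1,3)\<close> up to a term of weight 5, and so determines \<open>D(1,3)\<close> from \<open>H_n(4)\<close>.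
  The second is the alternating binomial transform
  \<open>T f(n) = \<Sum>k=1..n. (-1)^(k-1) (n choose k) f(k)\<close>. It exchanges division by \<open>k\<close> with
  summation of \<open>T f(m)/m\<close>, hence maps one harmonic sum to another exactly; on the other hand
  \<open>(-1)^k (p-1 choose k)\<close> is \<open>1 - p H_k\<close> modulo \<open>p^2\<close>, so at \<open>n = p - 1\<close> the transform is
  minus the plain sum of \<open>f\<close> plus \<open>p\<close> times the sum of \<open>H_k f(k)\<close>. Applied to \<open>1/k^4\<close>, whose
  transform is the complete homogeneous symmetric polynomial of degree 4 in \<open>1, 1/2, ..., 1/n\<close>,
  this determines \<open>H_n(4)\<close>; applied to \<open>H_k(3)/k\<close> it determines \<open>A\<close>. The results modulo \<open>p^2\<close> are
  \<open>H_n(4) = 4/5 p B\<close>, \<open>D(1,3) = -1/10 p B\<close> and \<open>A = 4/5 p B\<close>, so that the wanted sum is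
  \<open>(6 * 4/5 + 4/10 + 4/5)/4 = 3/2\<close> times \<open>p B\<close>.
\<close>

section \<open>Harmonic sums\<close>

definition gen_harm :: "nat \<Rightarrow> nat \<Rightarrow> rat" where
  "gen_harm a n = (\<Sum>k=1..n. 1 / of_nat k ^ a)"

lemma gen_harm_Suc: "gen_harm a (Suc n) = gen_harm a n + 1 / of_nat (Suc n) ^ a"
  by (simp add: gen_harm_def)

definition double_harm :: "nat \<Rightarrow> nat \<Rightarrow> nat \<Rightarrow> rat" where
  "double_harm a b n = (\<Sum>j=1..n. gen_harm a j / of_nat j ^ b)"

lemma gen_harm_pred: "1 \<le> j \<Longrightarrow> gen_harm a (j - 1) = gen_harm a j - 1 / of_nat j ^ a"
  using gen_harm_Suc[of a "j - 1"] by simp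

lemma strict_double_harm:
  "(\<Sum>j=1..n. gen_harm a (j - 1) / of_nat j ^ b) = double_harm a b n - gen_harm (a + b) n"
proof -
  have "(\<Sum>j=1..n. gen_harm a (j - 1) / of_nat j ^ b)
      = (\<Sum>j=1..n. gen_harm a j / of_nat j ^ b - 1 / of_nat j ^ (a + b))"
    by (intro sum.cong) (auto simp: gen_harm_pred[simplified] diff_divide_distrib power_add)
  then show ?thesis by (simp add: double_harm_def gen_harm_def sum_subtractf)
qed

text \<open>Split the pairs \<open>(i, j)\<close> of indices of the product of the two sums into \<open>i \<le> j\<close> and
  \<open>j \<le> i\<close>; the diagonal is counted twice.\<close>
lemma double_harm_stuffle:
  "double_harm a b n + double_harm b a n = gen_harm a n * gen_harm b n + gen_harm (a + b) n"
proof (induction n)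
  case (Suc n)
  define x where "x = (1 / of_nat (Suc n) :: rat)"
  have pow: "c / of_nat (Suc n) ^ k = c * x ^ k" for c :: rat and k
    by (simp add: x_def power_one_over)
  have "double_harm a b (Suc n) = double_harm a b n + gen_harm a (Suc n) * x ^ b" for a b
    unfolding pow[symmetric] by (simp add: double_harm_def)
  with Suc.IH show ?case
    by (simp add: gen_harm_Suc pow del: of_nat_Suc) (simp add: algebra_simps power_add)
qed (simp add: double_harm_def gen_harm_def)

text \<open>The right-hand sides are Newton's expressions, in terms of power sums, of the complete
  homogeneous symmetric polynomials \<open>h_2\<close>, \<open>h_3\<close>, \<open>h_4\<close> in \<open>1, 1/2, ..., 1/n\<close>. Sorting the
  monomials of \<open>h_(d+1)\<close> by their largest index \<open>m\<close> gives the recursion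
  \<open>h_(d+1)(n) = \<Sum>m=1..n. h_d(m)/m\<close>.\<close>
lemma gen_harm_symmetric_sums:
  shows "(\<Sum>m=1..n. gen_harm 1 m / of_nat m) = (gen_harm 1 n ^ 2 + gen_harm 2 n) / 2"
    and "(\<Sum>m=1..n. (gen_harm 1 m ^ 2 + gen_harm 2 m) / 2 / of_nat m)
      = (gen_harm 1 n ^ 3 + 3 * gen_harm 1 n * gen_harm 2 n + 2 * gen_harm 3 n) / 6"
    and "(\<Sum>m=1..n. (gen_harm 1 m ^ 3 + 3 * gen_harm 1 m * gen_harm 2 m + 2 * gen_harm 3 m) / 6 / of_nat m)
      = (gen_harm 1 n ^ 4 + 6 * gen_harm 1 n ^ 2 * gen_harm 2 n + 3 * gen_harm 2 n ^ 2
         + 8 * gen_harm 1 n * gen_harm 3 n + 6 * gen_harm 4 n) / 24"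
proof -
  define x where "x n = (1 / of_nat (Suc n) :: rat)" for n
  have pow: "c / of_nat (Suc n) ^ k = c * x n ^ k" "c / of_nat (Suc n) = c * x n"
    "c / (d * of_nat (Suc n)) = c / d * x n" for c d :: rat and k n
    by (simp_all add: x_def power_one_over)
  have exp: "y ^ 2 = y * y" "y ^ 3 = y * y * y" "y ^ 4 = y * y * y * y" for y :: rat
    by (simp_all add: power2_eq_square power3_eq_cube power4_eq_xxxx)
  show "(\<Sum>m=1..n. gen_harm 1 m / of_nat m) = (gen_harm 1 n ^ 2 + gen_harm 2 n) / 2"
    by (induction n) (simp_all add: gen_harm_def[of _ 0] gen_harm_Suc pow del: of_nat_Suc,
      simp_all add: exp add_divide_distrib algebra_simps)
  show "(\<Sum>m=1..n. (gen_harm 1 m ^ 2 + gen_harm 2 m) / 2 / of_nat m)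
      = (gen_harm 1 n ^ 3 + 3 * gen_harm 1 n * gen_harm 2 n + 2 * gen_harm 3 n) / 6"
    by (induction n) (simp_all add: gen_harm_def[of _ 0] gen_harm_Suc pow del: of_nat_Suc,
      simp_all add: exp add_divide_distrib algebra_simps)
  show "(\<Sum>m=1..n. (gen_harm 1 m ^ 3 + 3 * gen_harm 1 m * gen_harm 2 m + 2 * gen_harm 3 m) / 6 / of_nat m)
      = (gen_harm 1 n ^ 4 + 6 * gen_harm 1 n ^ 2 * gen_harm 2 n + 3 * gen_harm 2 n ^ 2
         + 8 * gen_harm 1 n * gen_harm 3 n + 6 * gen_harm 4 n) / 24"
    by (induction n) (simp_all add: gen_harm_def[of _ 0] gen_harm_Suc pow del: of_nat_Suc,
      simp_all add: exp add_divide_distrib algebra_simps)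
qed

text \<open>Expand \<open>H_j^4 - (H_j - 1/j)^4\<close> and sum over \<open>j\<close>.\<close>
lemma sum_harm_cube_telescope:
  "4 * (\<Sum>j=1..n. gen_harm 1 j ^ 3 / of_nat j)
     = gen_harm 1 n ^ 4 + 6 * (\<Sum>j=1..n. gen_harm 1 j ^ 2 / of_nat j ^ 2)
       - 4 * double_harm 1 3 n + gen_harm 4 n"
proof (induction n)
  case (Suc n)
  define x where "x = (1 / of_nat (Suc n) :: rat)"
  have pow: "c / of_nat (Suc n) ^ k = c * x ^ k" "c / of_nat (Suc n) = c * x" for c :: rat and k
    by (simp_all add: x_def power_one_over)
  have exp: "y ^ 2 = y * y" "y ^ 3 = y * y * y" "y ^ 4 = y * y * y * y" for y :: rat
    by (simp_all add: power2_eq_square power3_eq_cube power4_eq_xxxx)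
  have "double_harm 1 3 (Suc n) = double_harm 1 3 n + gen_harm 1 (Suc n) * x ^ 3"
    unfolding pow[symmetric] by (simp add: double_harm_def)
  with Suc.IH show ?case
    by (simp add: gen_harm_Suc pow del: of_nat_Suc) (simp add: exp algebra_simps)
qed (simp add: double_harm_def gen_harm_def)

text \<open>Summation by parts: \<open>2 H_k/k = H_k^2 - H_(k-1)^2 + 1/k^2\<close>, and the difference of squares is
  moved onto the factor \<open>H_k(3)\<close>.\<close>
lemma sum_harm_cubic_by_parts:
  "2 * (\<Sum>k=1..n. gen_harm 1 k * (gen_harm 3 k / of_nat k))
     = gen_harm 1 n ^ 2 * gen_harm 3 n - (\<Sum>k=1..n. gen_harm 1 (k - 1) ^ 2 / of_nat k ^ 3)
       + double_harm 3 2 n"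
proof (induction n)
  case (Suc n)
  define x where "x = (1 / of_nat (Suc n) :: rat)"
  have pow: "c / of_nat (Suc n) ^ k = c * x ^ k" "c / of_nat (Suc n) = c * x" for c :: rat and k
    by (simp_all add: x_def power_one_over)
  have exp: "y ^ 2 = y * y" "y ^ 3 = y * y * y" for y :: rat
    by (simp_all add: power2_eq_square power3_eq_cube)
  have "double_harm 3 2 (Suc n) = double_harm 3 2 n + gen_harm 3 (Suc n) * x ^ 2"
    unfolding pow[symmetric] by (simp add: double_harm_def)
  with Suc.IH show ?case
    by (simp add: gen_harm_Suc pow del: of_nat_Suc) (simp add: exp algebra_simps)
qed (simp add: double_harm_def gen_harm_def)

lemma sum_harm_square_pred:
  "(\<Sum>k=1..n. gen_harm 1 (k - 1) ^ 2 / of_nat k ^ 3)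
     = (\<Sum>k=1..n. gen_harm 1 k ^ 2 / of_nat k ^ 3) - 2 * double_harm 1 4 n + gen_harm 5 n"
proof -
  have "(\<Sum>k=1..n. gen_harm 1 (k - 1) ^ 2 / of_nat k ^ 3)
      = (\<Sum>k=1..n. gen_harm 1 k ^ 2 / of_nat k ^ 3 - 2 * (gen_harm 1 k / of_nat k ^ 4) + 1 / of_nat k ^ 5)"
  proof (rule sum.cong)
    fix k assume "k \<in> {1..n}"
    then show "gen_harm 1 (k - 1) ^ 2 / of_nat k ^ 3
        = gen_harm 1 k ^ 2 / of_nat k ^ 3 - 2 * (gen_harm 1 k / of_nat k ^ 4) + 1 / of_nat k ^ 5"
      by (simp add: gen_harm_pred[simplified] field_simps eval_nat_numeral)
  qed simp
  then show ?thesis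
    by (simp add: double_harm_def gen_harm_def sum.distrib sum_subtractf sum_distrib_left)
qed

section \<open>Alternating binomial sums\<close>

text \<open>Up to sign, the self-inverse binomial transform of the sequence \<open>f\<close> with \<open>f 0\<close> replaced by 0.\<close>
definition alt_binomial_sum :: "(nat \<Rightarrow> rat) \<Rightarrow> nat \<Rightarrow> rat" where
  "alt_binomial_sum f n = (\<Sum>k=1..n. (- 1) ^ (k - 1) * of_nat (n choose k) * f k)"

lemma alt_binomial_sum_shift:
  "alt_binomial_sum f n = (\<Sum>k<n. (- 1) ^ k * of_nat (n choose Suc k) * f (Suc k))"
  by (simp add: alt_binomial_sum_def sum.atLeast1_atMost_eq)

lemma alt_binomial_sum_one:
  assumes "n \<ge> 1"
  shows "alt_binomial_sum (\<lambda>k. 1) n = 1"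
proof -
  have "(\<Sum>k\<le>n. (- 1) ^ k * of_nat (n choose k)) = (0 :: rat)"
    using assms by (intro choose_alternating_sum) auto
  then show ?thesis
    by (simp add: alt_binomial_sum_shift sum.atMost_shift sum_negf)
qed

text \<open>Since \<open>(n+1 choose k) - (n choose k)\<close>, divided by \<open>k\<close>, equals \<open>(n+1 choose k)/(n+1)\<close>, passing
  from \<open>n\<close> to \<open>n + 1\<close> on the left adds the summand for \<open>m = n + 1\<close> on the right.\<close>
lemma alt_binomial_sum_divide:
  "alt_binomial_sum (\<lambda>k. f k / of_nat k) n = (\<Sum>m=1..n. alt_binomial_sum f m / of_nat m)"
proof (induction n)
  case (Suc n)
  have "alt_binomial_sum (\<lambda>k. f k / of_nat k) (Suc n) =
      (\<Sum>k<Suc n. (- 1) ^ k * of_nat (n choose Suc k) * (f (Suc k) / of_nat (Suc k))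
        + (- 1) ^ k * of_nat (Suc n choose Suc k) * f (Suc k) / of_nat (Suc n))"
    unfolding alt_binomial_sum_shift
  proof (rule sum.cong)
    fix k
    have "(of_nat (Suc k) * of_nat (Suc n choose Suc k) :: rat) = of_nat (Suc n) * of_nat (n choose k)"
      by (metis Suc_times_binomial of_nat_mult)
    then have "of_nat (n choose k) / of_nat (Suc k) = (of_nat (Suc n choose Suc k) / of_nat (Suc n) :: rat)"
      by (simp add: field_simps del: of_nat_Suc binomial_Suc_Suc)
    then have "(- 1) ^ k * of_nat (Suc n choose Suc k) * f (Suc k) / of_nat (Suc n)
        = (- 1) ^ k * f (Suc k) * (of_nat (n choose k) / of_nat (Suc k))"
      by simp
    then show "(- 1) ^ k * of_nat (Suc n choose Suc k) * (f (Suc k) / of_nat (Suc k))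
      = (- 1) ^ k * of_nat (n choose Suc k) * (f (Suc k) / of_nat (Suc k))
        + (- 1) ^ k * of_nat (Suc n choose Suc k) * f (Suc k) / of_nat (Suc n)"
      by (simp add: algebra_simps add_divide_distrib del: of_nat_Suc)
  qed simp
  also have "\<dots> = alt_binomial_sum (\<lambda>k. f k / of_nat k) n + alt_binomial_sum f (Suc n) / of_nat (Suc n)"
    unfolding sum.distrib alt_binomial_sum_shift sum_divide_distrib by simp
  finally show ?case using Suc.IH by simp
qed (simp add: alt_binomial_sum_def)

text \<open>The rule dual to the preceding one. Pascal's rule splits the transform of the partial sums
  \<open>F\<close> into two sums; after inserting \<open>F(k+1) = F(k) + h(k+1)\<close> into the first, its \<open>F\<close> part
  cancels against the second, and only \<open>h\<close> is left.\<close>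
lemma alt_binomial_sum_partial_sums:
  "alt_binomial_sum (\<lambda>k. \<Sum>m=1..k. h m) n = alt_binomial_sum (\<lambda>m. of_nat m * h m) n / of_nat n"
proof (cases n)
  case (Suc N)
  define F where "F k = (\<Sum>m=1..k. h m)" for k
  have F: "F 0 = 0" "F (Suc k) = F k + h (Suc k)" for k by (simp_all add: F_def)
  let ?X = "\<Sum>k<N. (- 1) ^ k * of_nat (N choose Suc k) * F (Suc k)"
  have "alt_binomial_sum F n = (\<Sum>k\<le>N. (- 1) ^ k * of_nat (N choose k) * F (Suc k)) + ?X"
    by (simp add: alt_binomial_sum_shift Suc lessThan_Suc_atMost distrib_left distrib_right sum.distrib)
       (simp add: lessThan_Suc_atMost[symmetric])
  also have "(\<Sum>k\<le>N. (- 1) ^ k * of_nat (N choose k) * F (Suc k))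
      = (\<Sum>k\<le>N. (- 1) ^ k * of_nat (N choose k) * F k)
        + (\<Sum>k\<le>N. (- 1) ^ k * of_nat (N choose k) * h (Suc k))"
    by (simp add: F(2) distrib_left sum.distrib)
  also have "(\<Sum>k\<le>N. (- 1) ^ k * of_nat (N choose k) * F k) = - ?X"
    by (simp add: sum.atMost_shift F(1) sum_negf del: F_def)
  also have "(\<Sum>k\<le>N. (- 1) ^ k * of_nat (N choose k) * h (Suc k))
      = alt_binomial_sum (\<lambda>m. of_nat m * h m) n / of_nat n"
    unfolding alt_binomial_sum_shift Suc lessThan_Suc_atMost sum_divide_distrib
  proof (rule sum.cong)
    fix k
    have "(of_nat (Suc N choose Suc k) * of_nat (Suc k) :: rat) = of_nat (Suc N) * of_nat (N choose k)"
      by (metis Suc_times_binomial of_nat_mult mult.commute)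
    then show "(- 1) ^ k * of_nat (N choose k) * h (Suc k) =
        (- 1) ^ k * of_nat (Suc N choose Suc k) * (of_nat (Suc k) * h (Suc k)) / of_nat (Suc N)"
      by (simp add: field_simps del: of_nat_Suc binomial_Suc_Suc)
  qed simp
  finally show ?thesis by (simp add: F_def)
qed (simp add: alt_binomial_sum_def)

text \<open>The transform of the constant 1 is 1, and each further division by \<open>k\<close> raises the degree of
  the complete homogeneous symmetric polynomial by one.\<close>
lemma alt_binomial_sum_reciprocal_powers:
  shows "alt_binomial_sum (\<lambda>k. 1 / of_nat k ^ 2) n = (gen_harm 1 n ^ 2 + gen_harm 2 n) / 2"
    and "alt_binomial_sum (\<lambda>k. 1 / of_nat k ^ 4) n =
      (gen_harm 1 n ^ 4 + 6 * gen_harm 1 n ^ 2 * gen_harm 2 n + 3 * gen_harm 2 n ^ 2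
         + 8 * gen_harm 1 n * gen_harm 3 n + 6 * gen_harm 4 n) / 24"
proof -
  have 1: "alt_binomial_sum (\<lambda>k. 1 / of_nat k) n = gen_harm 1 n" for n
    unfolding alt_binomial_sum_divide gen_harm_def
    by (intro sum.cong) (auto simp: alt_binomial_sum_one)
  have 2: "alt_binomial_sum (\<lambda>k. 1 / of_nat k ^ 2) n = (gen_harm 1 n ^ 2 + gen_harm 2 n) / 2" for n
    using alt_binomial_sum_divide[of "\<lambda>k. 1 / of_nat k" n]
    by (simp only: 1 gen_harm_symmetric_sums) (simp add: power2_eq_square)
  have 3: "alt_binomial_sum (\<lambda>k. 1 / of_nat k ^ 3) n =
      (gen_harm 1 n ^ 3 + 3 * gen_harm 1 n * gen_harm 2 n + 2 * gen_harm 3 n) / 6" for n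
    using alt_binomial_sum_divide[of "\<lambda>k. 1 / of_nat k ^ 2" n]
    by (simp only: 2 gen_harm_symmetric_sums) (simp add: power2_eq_square power3_eq_cube)
  have 4: "alt_binomial_sum (\<lambda>k. 1 / of_nat k ^ 4) n =
      (gen_harm 1 n ^ 4 + 6 * gen_harm 1 n ^ 2 * gen_harm 2 n + 3 * gen_harm 2 n ^ 2
         + 8 * gen_harm 1 n * gen_harm 3 n + 6 * gen_harm 4 n) / 24" for n
    using alt_binomial_sum_divide[of "\<lambda>k. 1 / of_nat k ^ 3" n]
    by (simp only: 3 gen_harm_symmetric_sums) (simp add: power3_eq_cube power4_eq_xxxx)
  show "alt_binomial_sum (\<lambda>k. 1 / of_nat k ^ 2) n = (gen_harm 1 n ^ 2 + gen_harm 2 n) / 2"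
    and "alt_binomial_sum (\<lambda>k. 1 / of_nat k ^ 4) n =
      (gen_harm 1 n ^ 4 + 6 * gen_harm 1 n ^ 2 * gen_harm 2 n + 3 * gen_harm 2 n ^ 2
         + 8 * gen_harm 1 n * gen_harm 3 n + 6 * gen_harm 4 n) / 24"
    by (fact 2 4)+
qed

text \<open>\<open>H_k(3)\<close> is a sequence of partial sums, so its transform at \<open>m\<close> is that of \<open>1/k^2\<close> divided by
  \<open>m\<close>; the remaining division by \<open>k\<close> becomes a summation.\<close>
lemma alt_binomial_sum_gen_harm_3:
  "alt_binomial_sum (\<lambda>k. gen_harm 3 k / of_nat k) n
     = (\<Sum>m=1..n. (gen_harm 1 m ^ 2 + gen_harm 2 m) / (2 * of_nat m ^ 2))"
  unfolding alt_binomial_sum_divide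
proof (rule sum.cong)
  fix m assume "m \<in> {1..n}"
  have "alt_binomial_sum (gen_harm 3) m = alt_binomial_sum (\<lambda>k. of_nat k * (1 / of_nat k ^ 3)) m / of_nat m"
    using alt_binomial_sum_partial_sums[of "\<lambda>k. 1 / of_nat k ^ 3" m]
    by (simp add: gen_harm_def[abs_def])
  also have "alt_binomial_sum (\<lambda>k. of_nat k * (1 / of_nat k ^ 3)) m = alt_binomial_sum (\<lambda>k. 1 / of_nat k ^ 2) m"
    by (simp add: alt_binomial_sum_def power2_eq_square power3_eq_cube cong: if_cong)
  also have "\<dots> = (gen_harm 1 m ^ 2 + gen_harm 2 m) / 2"
    by (rule alt_binomial_sum_reciprocal_powers)
  finally show "alt_binomial_sum (gen_harm 3) m / of_nat m = (gen_harm 1 m ^ 2 + gen_harm 2 m) / (2 * of_nat m ^ 2)"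
    by (simp add: power2_eq_square)
qed simp

section \<open>Faulhaber's formula\<close>

text \<open>Compare coefficients of \<open>X^(m+1)\<close> in \<open>X * (\<Sum>i<n. exp(i X)) = b * (exp(n X) - 1)\<close>, where \<open>b\<close> is
  the generating function of the Bernoulli numbers. It is the geometric sum multiplied by \<open>b\<close>,
  since \<open>b * (exp X - 1) = X\<close>.\<close>
lemma sum_powers_bernoulli:
  "of_nat (Suc m) * (\<Sum>i<n. of_nat i ^ m) =
     (\<Sum>k\<le>m. of_nat (Suc m choose k) * bernoulli k * of_nat n ^ (Suc m - k))"
proof -
  define b where "b = Abs_fps (\<lambda>n. bernoulli n / fact n)"
  define G where "G = (\<Sum>i<n. fps_exp (of_nat i :: rat))"
  have "G * (fps_exp 1 - 1) = fps_exp (of_nat n) - 1"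
    using one_diff_power_eq[of "fps_exp (1::rat)" n]
    by (simp add: G_def fps_exp_power_mult algebra_simps)
  then have "fps_X * G = b * (fps_exp (of_nat n) - 1)"
    using bernoulli_fps unfolding b_def[symmetric] by (metis mult.assoc mult.commute)
  then have "fps_nth (fps_X * G) (Suc m) = fps_nth (b * (fps_exp (of_nat n) - 1)) (Suc m)"
    by simp
  moreover have "fps_nth (fps_X * G) (Suc m) = (\<Sum>i<n. of_nat i ^ m) / fact m"
    by (simp add: G_def fps_sum_nth sum_divide_distrib)
  moreover have "fps_nth (b * (fps_exp (of_nat n) - 1)) (Suc m) =
      (\<Sum>k\<le>m. bernoulli k / fact k * (of_nat n ^ (Suc m - k) / fact (Suc m - k)))"
    by (simp add: fps_mult_nth b_def atLeast0AtMost sum.atMost_Suc) (simp add: mult_ac)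
  ultimately have "(\<Sum>i<n. of_nat i ^ m) / fact m =
      (\<Sum>k\<le>m. bernoulli k / fact k * (of_nat n ^ (Suc m - k) / fact (Suc m - k)))" by simp
  then have "of_nat (Suc m) * (\<Sum>i<n. of_nat i ^ m) = fact (Suc m) *
      (\<Sum>k\<le>m. bernoulli k / fact k * (of_nat n ^ (Suc m - k) / fact (Suc m - k)))"
    by (simp add: field_simps)
  also have "\<dots> = (\<Sum>k\<le>m. of_nat (Suc m choose k) * bernoulli k * of_nat n ^ (Suc m - k))"
    unfolding sum_distrib_left
    by (rule sum.cong) (simp_all add: binomial_fact field_simps del: fact_Suc)
  finally show ?thesis .
qed

section \<open>Congruences between $p$-integral rationals\<close>

text \<open>The localization of the integers at \<open>p\<close>. It is easier to compute in than the condition on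
  reduced fractions, to which it is equivalent by \<open>p_integral_iff_quotient_of\<close>.\<close>
definition p_integral :: "nat \<Rightarrow> rat set" where
  "p_integral p = {of_int a / of_int b | a b. \<not> int p dvd b}"

text \<open>Congruence modulo \<open>p^e\<close> in the localization, but for arbitrary rationals \<open>x\<close>, \<open>y\<close>: transitivity,
  sums and cancellation then need no side conditions about integrality.\<close>
definition pcong :: "nat \<Rightarrow> nat \<Rightarrow> rat \<Rightarrow> rat \<Rightarrow> bool" where
  "pcong p e x y \<longleftrightarrow> (\<exists>z\<in>p_integral p. x - y = of_nat p ^ e * z)"

context
  fixes p :: nat
  assumes prime_p: "prime p"
begin

lemma p_integral_of_int [simp, intro]: "of_int a \<in> p_integral p"
proof -
  have "\<not> int p dvd 1" using prime_p by (auto dest: prime_gt_1_nat)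
  then show ?thesis unfolding p_integral_def
    by (intro CollectI exI[of _ a] exI[of _ "1::int"]) auto
qed

lemma p_integral_of_nat [simp, intro]: "of_nat a \<in> p_integral p"
  using p_integral_of_int[of "int a"] by simp

lemma p_integral_0 [simp, intro]: "0 \<in> p_integral p"
  using p_integral_of_int[of 0] by simp

lemma p_integral_1 [simp, intro]: "1 \<in> p_integral p"
  using p_integral_of_int[of 1] by simp

lemma p_integral_numeral [simp, intro]: "numeral w \<in> p_integral p"
  using p_integral_of_int[of "numeral w"] by simp

lemma prime_int_p: "prime (int p)"
  using prime_p by simp

lemma p_integral_add [intro]:
  assumes "x \<in> p_integral p" "y \<in> p_integral p"
  shows "x + y \<in> p_integral p"
proof -
  from assms obtain a b c d where
    *: "x = of_int a / of_int b" "\<not> int p dvd b" "y = of_int c / of_int d" "\<not> int p dvd d"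
    unfolding p_integral_def by auto
  then have "b \<noteq> 0" "d \<noteq> 0" by auto
  then have "x + y = of_int (a * d + c * b) / of_int (b * d)"
    using * by (simp add: field_simps)
  moreover have "\<not> int p dvd b * d"
    using * prime_int_p by (simp add: prime_dvd_mult_iff)
  ultimately show ?thesis unfolding p_integral_def by blast
qed

lemma p_integral_mult [intro]:
  assumes "x \<in> p_integral p" "y \<in> p_integral p"
  shows "x * y \<in> p_integral p"
proof -
  from assms obtain a b c d where
    *: "x = of_int a / of_int b" "\<not> int p dvd b" "y = of_int c / of_int d" "\<not> int p dvd d"
    unfolding p_integral_def by auto
  then have "x * y = of_int (a * c) / of_int (b * d)" by simp
  moreover have "\<not> int p dvd b * d"
    using * prime_int_p by (simp add: prime_dvd_mult_iff)
  ultimately show ?thesis unfolding p_integral_def by blast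
qed

lemma p_integral_minus [intro]: "x \<in> p_integral p \<Longrightarrow> - x \<in> p_integral p"
  using p_integral_mult[of "of_int (-1)" x, OF p_integral_of_int] by simp

lemma p_integral_diff [intro]:
  "x \<in> p_integral p \<Longrightarrow> y \<in> p_integral p \<Longrightarrow> x - y \<in> p_integral p"
  using p_integral_add[of x "- y"] by auto

lemma p_integral_power [intro]: "x \<in> p_integral p \<Longrightarrow> x ^ k \<in> p_integral p"
  by (induction k) auto

lemma p_integral_sum [intro]:
  "(\<And>i. i \<in> A \<Longrightarrow> f i \<in> p_integral p) \<Longrightarrow> sum f A \<in> p_integral p"
  by (induction A rule: infinite_finite_induct) auto

lemmas p_integral_intros =
  p_integral_add p_integral_mult p_integral_minus p_integral_diff p_integral_power p_integral_sum

lemma p_integral_divide: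
  assumes "x \<in> p_integral p" "\<not> p dvd j"
  shows "x / of_nat j \<in> p_integral p"
proof -
  have "1 / of_nat j \<in> p_integral p"
    unfolding p_integral_def using assms(2)
    by (intro CollectI exI[of _ 1] exI[of _ "int j"]) auto
  from p_integral_mult[OF assms(1) this] show ?thesis by simp
qed

lemma p_integral_divide_power:
  assumes "x \<in> p_integral p" "\<not> p dvd j"
  shows "x / of_nat j ^ a \<in> p_integral p"
  using p_integral_divide[of x "j ^ a"] assms prime_p prime_dvd_power by auto

lemma pcong_refl [simp, intro]: "pcong p e x x"
  unfolding pcong_def by (rule bexI[of _ 0]) auto

lemma pcong_sym: "pcong p e x y \<Longrightarrow> pcong p e y x"
  unfolding pcong_def by (metis p_integral_minus minus_diff_eq mult_minus_right)

lemma pcong_add: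
  assumes "pcong p e x y" "pcong p e u v"
  shows "pcong p e (x + u) (y + v)"
proof -
  from assms obtain z w where "z \<in> p_integral p" "w \<in> p_integral p"
    "x - y = of_nat p ^ e * z" "u - v = of_nat p ^ e * w"
    unfolding pcong_def by blast
  then show ?thesis unfolding pcong_def
    by (intro bexI[of _ "z + w"]) (auto simp: algebra_simps)
qed

lemma pcong_trans [trans]: "pcong p e x y \<Longrightarrow> pcong p e y z \<Longrightarrow> pcong p e x z"
  using pcong_add[of e x y y z] unfolding pcong_def by simp

lemma pcong_mult_left:
  assumes "pcong p e x y" "c \<in> p_integral p"
  shows "pcong p e (c * x) (c * y)"
proof -
  from assms obtain z where "z \<in> p_integral p" "x - y = of_nat p ^ e * z"
    unfolding pcong_def by blast
  then show ?thesis unfolding pcong_def using assms(2)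
    by (intro bexI[of _ "c * z"]) (auto simp: algebra_simps)
qed

lemma pcong_minus: "pcong p e x y \<Longrightarrow> pcong p e (- x) (- y)"
  using pcong_mult_left[of e x y "of_int (-1)", OF _ p_integral_of_int] by simp

lemma pcong_diff:
  "pcong p e x y \<Longrightarrow> pcong p e u v \<Longrightarrow> pcong p e (x - u) (y - v)"
  using pcong_add[of e x y "- u" "- v"] pcong_minus by auto

lemma pcong_mult:
  assumes "pcong p e x y" "pcong p e u v" "x \<in> p_integral p" "v \<in> p_integral p"
  shows "pcong p e (x * u) (y * v)"
  using pcong_trans[OF pcong_mult_left[OF assms(2,3)] pcong_mult_left[OF assms(1,4), unfolded mult.commute[of v]]]
  .

lemma pcong_power:
  assumes "pcong p e x y" "x \<in> p_integral p" "y \<in> p_integral p"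
  shows "pcong p e (x ^ k) (y ^ k)"
  by (induction k) (use assms in \<open>auto intro!: pcong_mult\<close>)

lemma pcong_sum:
  "(\<And>i. i \<in> A \<Longrightarrow> pcong p e (f i) (g i)) \<Longrightarrow> pcong p e (sum f A) (sum g A)"
  by (induction A rule: infinite_finite_induct) (auto intro: pcong_add)

lemma pcong_prod:
  assumes "\<And>i. i \<in> A \<Longrightarrow> pcong p e (f i) (g i)"
    and "\<And>i. i \<in> A \<Longrightarrow> f i \<in> p_integral p" "\<And>i. i \<in> A \<Longrightarrow> g i \<in> p_integral p"
  shows "pcong p e (prod f A) (prod g A)"
proof -
  have "pcong p e (prod f A) (prod g A) \<and> prod f A \<in> p_integral p \<and> prod g A \<in> p_integral p"
    using assms by (induction A rule: infinite_finite_induct) (auto intro: pcong_mult)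
  then show ?thesis by blast
qed

lemma pcong_mult_p:
  "pcong p e x y \<Longrightarrow> pcong p (Suc e) (of_nat p * x) (of_nat p * y)"
  unfolding pcong_def by (auto simp: algebra_simps)

lemma pcong_p_power_mult: "z \<in> p_integral p \<Longrightarrow> pcong p e (of_nat p ^ e * z) 0"
  unfolding pcong_def by auto

lemma pcong_weaken:
  assumes "pcong p e x y" "d \<le> e"
  shows "pcong p d x y"
proof -
  from assms(1) obtain z where z: "z \<in> p_integral p" "x - y = of_nat p ^ e * z"
    unfolding pcong_def by blast
  moreover have "(of_nat p :: rat) ^ e = of_nat p ^ d * of_nat p ^ (e - d)"
    using assms(2) by (simp flip: power_add)
  ultimately show ?thesis
    unfolding pcong_def by (intro bexI[of _ "of_nat p ^ (e - d) * z"]) auto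
qed

lemma pcong_cancel:
  assumes "pcong p e (of_nat c * x) (of_nat c * y)" "\<not> p dvd c"
  shows "pcong p e x y"
proof -
  from assms obtain z where z: "z \<in> p_integral p" "of_nat c * x - of_nat c * y = of_nat p ^ e * z"
    unfolding pcong_def by blast
  have "c \<noteq> 0" using assms(2) by (cases c) auto
  then have "x - y = of_nat p ^ e * (z / of_nat c)"
    using z(2) by (simp add: field_simps)
  then show ?thesis unfolding pcong_def using p_integral_divide[OF z(1) assms(2)] by blast
qed

lemma p_integral_iff_quotient_of:
  "x \<in> p_integral p \<longleftrightarrow> coprime (snd (quotient_of x)) (int p)"
proof
  obtain a b where ab: "quotient_of x = (a, b)" by force
  then have x: "x = of_int a / of_int b" "coprime a b" "b > 0"
    by (auto simp: quotient_of_div quotient_of_coprime quotient_of_denom_pos)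
  show "coprime (snd (quotient_of x)) (int p)" if "x \<in> p_integral p"
  proof -
    from that obtain c d where cd: "x = of_int c / of_int d" "\<not> int p dvd d"
      unfolding p_integral_def by auto
    then have "d \<noteq> 0" by auto
    then have "(of_int (a * d) :: rat) = of_int (b * c)"
      using x cd by (simp add: field_simps)
    then have eq: "a * d = b * c" by (simp only: of_int_eq_iff)
    have "\<not> int p dvd b"
    proof
      assume b: "int p dvd b"
      then have "int p dvd a * d" using eq by simp
      then have "int p dvd a" using cd(2) prime_int_p by (simp add: prime_dvd_mult_iff)
      then have "is_unit (int p)" using coprime_common_divisor[OF x(2) _ b] by blast
      then show False using prime_int_p not_prime_unit by blast
    qed
    then show ?thesis using ab prime_imp_coprime[OF prime_int_p, of b]
      by (simp add: coprime_commute)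
  qed
  show "x \<in> p_integral p" if "coprime (snd (quotient_of x)) (int p)"
  proof -
    have "\<not> int p dvd b"
      using that ab prime_int_p by (metis snd_conv coprime_common_divisor dvd_refl not_prime_unit)
    then show ?thesis unfolding p_integral_def using x(1) by blast
  qed
qed

lemma qcong_if_pcong:
  assumes "x \<in> p_integral p" "y \<in> p_integral p" "pcong p e x y"
  shows "qcong x y (int p ^ e)"
proof -
  obtain a b where ab: "quotient_of (x - y) = (a, b)" by force
  then have xy: "x - y = of_int a / of_int b" "b > 0"
    by (auto simp: quotient_of_div quotient_of_denom_pos)
  from assms(3) obtain c d where cd: "x - y = of_nat p ^ e * (of_int c / of_int d)" "\<not> int p dvd d"
    unfolding pcong_def p_integral_def by auto
  then have "d \<noteq> 0" by auto
  then have "(of_int (a * d) :: rat) = of_int (int p ^ e * (b * c))"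
    using xy cd(1) by (simp add: field_simps)
  then have "a * d = int p ^ e * (b * c)" by (simp only: of_int_eq_iff)
  then have "int p ^ e dvd a * d" by simp
  moreover have "coprime (int p ^ e) d"
    using cd(2) prime_int_p by (simp add: prime_imp_coprime)
  ultimately have "int p ^ e dvd a" using coprime_dvd_mult_left_iff by blast
  then show ?thesis
    using assms(1,2) ab by (simp add: qcong_def p_integral_iff_quotient_of)
qed

section \<open>Power sums and Bernoulli numbers modulo $p$\<close>

text \<open>The recurrence determines the Bernoulli number of index \<open>k\<close> from earlier ones by a division by
  \<open>k + 1\<close>, which is a unit.\<close>
lemma bernoulli_p_integral: "k + 1 < p \<Longrightarrow> bernoulli k \<in> p_integral p"
proof (induction k rule: less_induct)
  case (less k)
  have "(\<Sum>i\<le>k. of_nat (Suc k choose i) * bernoulli i)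
      = (\<Sum>i<k. of_nat (Suc k choose i) * bernoulli i) + of_nat (Suc k) * bernoulli k"
    by (simp add: lessThan_Suc_atMost[symmetric])
  with bernoulli_recurrence[of k]
  have eq: "bernoulli k = ((if k = 0 then 1 else 0)
      - (\<Sum>i<k. of_nat (Suc k choose i) * bernoulli i)) / of_nat (Suc k)"
    by (simp add: field_simps del: of_nat_Suc)
  have "(if k = 0 then 1 else 0) - (\<Sum>i<k. of_nat (Suc k choose i) * bernoulli i)
      \<in> p_integral p"
    using less by (intro p_integral_diff p_integral_sum p_integral_mult) auto
  moreover have "\<not> p dvd Suc k" using less.prems by (auto dest: dvd_imp_le)
  ultimately show ?case unfolding eq by (rule p_integral_divide)
qed

lemma pcong_of_nat:
  assumes "[a = b] (mod p)"
  shows "pcong p 1 (of_nat a) (of_nat b)"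
proof -
  from assms have "int p dvd int a - int b"
    by (simp flip: cong_int_iff add: cong_iff_dvd_diff)
  then obtain c where "int a - int b = int p * c" by auto
  then have "(of_int (int a - int b) :: rat) = of_int (int p * c)" by simp
  then show ?thesis unfolding pcong_def by (intro bexI[of _ "of_int c"]) auto
qed

lemma pcong_fermat: "\<not> p dvd j \<Longrightarrow> pcong p 1 (of_nat j ^ (p - 1)) 1"
  using pcong_of_nat[OF fermat_theorem[OF prime_p]] by simp

lemma inverse_power_pcong:
  assumes "\<not> p dvd j" "a \<le> p - 1"
  shows "pcong p 1 (1 / of_nat j ^ a) (of_nat j ^ (p - 1 - a))"
proof -
  have j: "j \<noteq> 0" using assms(1) by (cases j) auto
  have "pcong p 1 (1 / of_nat j ^ a * of_nat j ^ (p - 1)) (1 / of_nat j ^ a * 1)"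
    using assms by (intro pcong_mult_left pcong_fermat p_integral_divide_power) auto
  moreover have "1 / of_nat j ^ a * of_nat j ^ (p - 1) = (of_nat j ^ (p - 1 - a) :: rat)"
    using power_diff[of "of_nat j :: rat" a "p - 1"] assms(2) j by simp
  ultimately show ?thesis using pcong_sym by simp
qed

lemma not_dvd_residue: "j \<in> {1..p - 1} \<Longrightarrow> \<not> p dvd j"
  using prime_p by (auto dest!: dvd_imp_le)

lemma lessThan_p: "{..<p} = insert 0 {1..p - 1}"
  using prime_gt_0_nat[OF prime_p] by auto

text \<open>Every term of Faulhaber's formula contains a factor \<open>p\<close>, and the Bernoulli numbers in it are
  \<open>p\<close>-integral because \<open>m < p - 1\<close>.\<close>
lemma power_sum_pcong_small:
  assumes "0 < m" "m < p - 1"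
  shows "pcong p 1 (\<Sum>j=1..p-1. of_nat j ^ m) 0"
proof -
  have "pcong p 1 (\<Sum>k\<le>m. of_nat (Suc m choose k) * bernoulli k * of_nat p ^ (Suc m - k)) (\<Sum>k\<le>m. 0)"
  proof (rule pcong_sum)
    fix k assume k: "k \<in> {..m}"
    then have "bernoulli k \<in> p_integral p"
      using assms by (intro bernoulli_p_integral) auto
    then have "pcong p 1 (of_nat p ^ 1 * (of_nat (Suc m choose k) * bernoulli k * of_nat p ^ (m - k))) 0"
      by (intro pcong_p_power_mult p_integral_mult p_integral_power) auto
    then show "pcong p 1 (of_nat (Suc m choose k) * bernoulli k * of_nat p ^ (Suc m - k)) 0"
      using k by (simp add: Suc_diff_le mult_ac)
  qed
  then have "pcong p 1 (of_nat (Suc m) * (\<Sum>i<p. of_nat i ^ m)) (of_nat (Suc m) * 0)"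
    by (simp only: sum_powers_bernoulli) simp
  then have "pcong p 1 (\<Sum>i<p. of_nat i ^ m) 0"
    by (rule pcong_cancel) (use assms in \<open>auto dest: dvd_imp_le\<close>)
  then show ?thesis using assms by (simp add: lessThan_p power_0_left)
qed

text \<open>Fermat's theorem reduces the exponent modulo \<open>p - 1\<close>, and for exponent 0 the sum is
  \<open>p - 1\<close>.\<close>
lemma power_sum_pcong:
  "pcong p 1 (\<Sum>j=1..p-1. of_nat j ^ m) (if p - 1 dvd m then - 1 else 0)"
proof -
  define r q where "r = m mod (p - 1)" and "q = m div (p - 1)"
  have m: "m = r + (p - 1) * q" by (simp add: r_def q_def)
  have "pcong p 1 (\<Sum>j=1..p-1. of_nat j ^ m) (\<Sum>j=1..p-1. of_nat j ^ r)"
  proof (rule pcong_sum)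
    fix j assume "j \<in> {1..p-1}"
    then have "pcong p 1 ((of_nat j ^ (p - 1)) ^ q) (1 ^ q)"
      by (intro pcong_power pcong_fermat not_dvd_residue p_integral_power) auto
    then have "pcong p 1 (of_nat j ^ r * (of_nat j ^ (p - 1)) ^ q) (of_nat j ^ r * 1 ^ q)"
      by (intro pcong_mult_left p_integral_power) auto
    then show "pcong p 1 (of_nat j ^ m) (of_nat j ^ r)"
      by (simp add: m power_add power_mult)
  qed
  also have "pcong p 1 (\<Sum>j=1..p-1. of_nat j ^ r) (if p - 1 dvd m then - 1 else 0)"
  proof (cases "r = 0")
    case True
    have "of_nat (p - 1) - (- 1) = (of_nat p :: rat) ^ 1 * 1"
      using prime_gt_0_nat[OF prime_p] by (simp add: of_nat_diff)
    then have "pcong p 1 (of_nat (p - 1)) (- 1)"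
      unfolding pcong_def by (intro bexI[of _ 1]) auto
    with True show ?thesis by (simp add: r_def dvd_eq_mod_eq_0)
  next
    case False
    then have "r < p - 1" unfolding r_def
      using prime_gt_1_nat[OF prime_p] by (intro mod_less_divisor) auto
    with False show ?thesis
      using power_sum_pcong_small[of r] by (simp add: r_def dvd_eq_mod_eq_0)
  qed
  finally show ?thesis .
qed

lemma gen_harm_p_integral [intro]: "n < p \<Longrightarrow> gen_harm a n \<in> p_integral p"
  unfolding gen_harm_def by (intro p_integral_sum p_integral_divide_power) (auto dest: dvd_imp_le)

lemma gen_harm_pcong_0:
  assumes "1 \<le> a" "a + 1 < p"
  shows "pcong p 1 (gen_harm a (p - 1)) 0"
proof -
  have "pcong p 1 (gen_harm a (p - 1)) (\<Sum>j=1..p-1. of_nat j ^ (p - 1 - a))"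
    unfolding gen_harm_def using assms
    by (intro pcong_sum inverse_power_pcong not_dvd_residue) auto
  also have "pcong p 1 \<dots> 0"
    using assms by (intro power_sum_pcong_small) auto
  finally show ?thesis .
qed

text \<open>\<open>b!\<close> is a unit because \<open>b < p\<close>, so modulo \<open>p\<close> the binomial coefficient depends only on the
  residue of its upper argument: \<open>p - a\<close> may be replaced by \<open>-a\<close>, and negation of the upper
  argument does the rest.\<close>
lemma choose_pcong:
  assumes "1 \<le> a" "a \<le> p" "b < p"
  shows "pcong p 1 (of_nat (p - a choose b)) ((- 1) ^ b * of_nat (a + b - 1 choose b))"
proof -
  have "pcong p 1 (\<Prod>i=0..<b. of_nat (p - a) - of_nat i) (\<Prod>i=0..<b. - of_nat a - of_nat i)"
  proof (rule pcong_prod)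
    show "pcong p 1 (of_nat (p - a) - of_nat i) (- of_nat a - of_nat i)" for i
      unfolding pcong_def using assms by (intro bexI[of _ 1]) (auto simp: of_nat_diff)
  qed auto
  moreover have "(\<Prod>i=0..<b. of_nat (p - a) - of_nat i) = (of_nat (fact b) * of_nat (p - a choose b) :: rat)"
    by (simp add: binomial_gbinomial gbinomial_mult_fact)
  moreover have "(\<Prod>i=0..<b. - of_nat a - of_nat i)
      = (of_nat (fact b) * ((- 1) ^ b * of_nat (a + b - 1 choose b)) :: rat)"
  proof -
    have "(\<Prod>i=0..<b. - of_nat a - of_nat i) = (fact b * (- of_nat a gchoose b) :: rat)"
      by (simp add: gbinomial_mult_fact)
    also have "(- of_nat a gchoose b :: rat) = (- 1) ^ b * (of_nat a + of_nat b - 1 gchoose b)"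
      by (rule gbinomial_minus)
    also have "of_nat a + of_nat b - 1 = (of_nat (a + b - 1) :: rat)"
      using assms by (simp add: of_nat_diff)
    finally show ?thesis by (simp add: binomial_gbinomial)
  qed
  ultimately have "pcong p 1 (of_nat (fact b) * of_nat (p - a choose b))
      (of_nat (fact b) * ((- 1) ^ b * of_nat (a + b - 1 choose b)))" by simp
  then show ?thesis
    by (rule pcong_cancel) (use assms prime_p in \<open>simp add: prime_dvd_fact_iff\<close>)
qed

text \<open>By Fermat, the sum is that of \<open>i^(p-1-a) j^(p-1-b)\<close> over \<open>i < j\<close>. Faulhaber's formula for the
  sum over \<open>i\<close> leaves a combination of power sums of \<open>j\<close> with exponents strictly between 0
  and \<open>2(p - 1)\<close>; the only one that survives has exponent \<open>p - 1\<close>, which belongs to the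
  Bernoulli number of index \<open>p - a - b\<close>.\<close>
lemma strict_double_harm_pcong:
  assumes "1 \<le> a" "1 \<le> b" "a + b < p"
  shows "pcong p 1 (of_nat a * (\<Sum>j=1..p-1. gen_harm a (j - 1) / of_nat j ^ b))
           ((- 1) ^ b * of_nat (a + b - 1 choose b) * bernoulli (p - a - b))"
proof -
  define G where "G = (\<Sum>j=1..p-1. gen_harm a (j - 1) / of_nat j ^ b)"
  define B where "B = bernoulli (p - a - b)"
  have B: "B \<in> p_integral p"
    unfolding B_def using assms by (intro bernoulli_p_integral) auto
  have G: "G \<in> p_integral p"
    unfolding G_def
    by (intro p_integral_sum p_integral_divide_power gen_harm_p_integral not_dvd_residue) auto
  have expand: "of_nat (p - a) * (\<Sum>i<j. of_nat i ^ (p - 1 - a)) =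
      (\<Sum>k\<le>p - 1 - a. of_nat (p - a choose k) * bernoulli k * of_nat j ^ (p - a - k))" for j :: nat
  proof -
    have "Suc (p - 1 - a) = p - a" using assms by simp
    then show ?thesis using sum_powers_bernoulli[of "p - 1 - a" j] by simp
  qed
  have "pcong p 1 (of_nat (p - a) * G)
      (of_nat (p - a) * (\<Sum>j=1..p-1. (\<Sum>i<j. of_nat i ^ (p - 1 - a)) * of_nat j ^ (p - 1 - b)))"
    unfolding G_def
  proof (intro pcong_mult_left pcong_sum)
    fix j assume j: "j \<in> {1..p-1}"
    have "{..<j} = insert 0 {1..j-1}" using j by auto
    then have "(\<Sum>i<j. of_nat i ^ (p - 1 - a)) = (\<Sum>i=1..j-1. of_nat i ^ (p - 1 - a) :: rat)"
      using assms by simp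
    moreover have "pcong p 1 (gen_harm a (j - 1)) (\<Sum>i=1..j-1. of_nat i ^ (p - 1 - a))"
      unfolding gen_harm_def using assms j
      by (intro pcong_sum inverse_power_pcong not_dvd_residue) auto
    ultimately have "pcong p 1 (gen_harm a (j - 1) * (1 / of_nat j ^ b))
       ((\<Sum>i<j. of_nat i ^ (p - 1 - a)) * of_nat j ^ (p - 1 - b))"
      using assms j
      by (intro pcong_mult inverse_power_pcong not_dvd_residue gen_harm_p_integral p_integral_power) auto
    then show "pcong p 1 (gen_harm a (j - 1) / of_nat j ^ b)
       ((\<Sum>i<j. of_nat i ^ (p - 1 - a)) * of_nat j ^ (p - 1 - b))" by simp
  qed auto
  also have "of_nat (p - a) * (\<Sum>j=1..p-1. (\<Sum>i<j. of_nat i ^ (p - 1 - a)) * of_nat j ^ (p - 1 - b))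
      = (\<Sum>j=1..p-1. \<Sum>k\<le>p - 1 - a.
          of_nat (p - a choose k) * bernoulli k * of_nat j ^ (p - a - k + (p - 1 - b)))"
  proof -
    have "of_nat (p - a) * ((\<Sum>i<j. of_nat i ^ (p - 1 - a)) * of_nat j ^ (p - 1 - b)) =
        (\<Sum>k\<le>p - 1 - a. of_nat (p - a choose k) * bernoulli k * of_nat j ^ (p - a - k + (p - 1 - b)))"
      for j :: nat
      by (subst mult.assoc[symmetric], subst expand) (simp only: sum_distrib_right sum_distrib_left power_add mult_ac)
    then show ?thesis by (simp only: sum_distrib_left)
  qed
  also have "\<dots> = (\<Sum>k\<le>p - 1 - a. of_nat (p - a choose k) * bernoulli k *
          (\<Sum>j=1..p-1. of_nat j ^ (p - a - k + (p - 1 - b))))"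
    unfolding sum_distrib_left by (rule sum.swap)
  also have "pcong p 1 \<dots> (\<Sum>k\<le>p - 1 - a. of_nat (p - a choose k) * bernoulli k *
          (if k = p - a - b then - 1 else 0))"
  proof (intro pcong_sum pcong_mult_left)
    fix k assume k: "k \<in> {..p - 1 - a}"
    define v where "v = p - a - k + (p - 1 - b)"
    \<comment> \<open>The exponent \<open>0 < v < 2(p - 1)\<close> is a multiple of \<open>p - 1\<close> for a single \<open>k\<close>.\<close>
    have "p - 1 dvd v \<longleftrightarrow> v = p - 1"
    proof
      assume "p - 1 dvd v"
      then obtain c where c: "v = (p - 1) * c" by auto
      have "0 < v" "v < (p - 1) * 2" using k assms by (auto simp: v_def)
      then have "0 < c" "c < 2" unfolding c by auto
      then have "c = 1" by simp
      with c show "v = p - 1" by simp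
    qed simp
    also have "v = p - 1 \<longleftrightarrow> k = p - a - b" using k assms by (auto simp: v_def)
    finally show "pcong p 1 (\<Sum>j=1..p-1. of_nat j ^ (p - a - k + (p - 1 - b)))
        (if k = p - a - b then - 1 else 0)"
      using power_sum_pcong[of v] by (simp add: v_def)
    show "of_nat (p - a choose k) * bernoulli k \<in> p_integral p"
      using k assms by (intro p_integral_mult bernoulli_p_integral) auto
  qed
  also have "(\<Sum>k\<le>p - 1 - a. of_nat (p - a choose k) * bernoulli k *
          (if k = p - a - b then - 1 else 0)) = - (B * of_nat (p - a choose b))"
  proof -
    have "p - a choose (p - a - b) = p - a choose b"
      using binomial_symmetric[of b "p - a"] assms by simp
    then show ?thesis using assms unfolding B_def
      by (simp add: if_distrib sum.delta cong: if_cong)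
  qed
  also have "pcong p 1 \<dots> (- (B * ((- 1) ^ b * of_nat (a + b - 1 choose b))))"
    using assms B by (intro pcong_minus pcong_mult_left choose_pcong) auto
  finally have "pcong p 1 (of_nat (p - a) * G)
      (- (B * ((- 1) ^ b * of_nat (a + b - 1 choose b))))" .
  \<comment> \<open>Trade the factor \<open>p - a\<close> from Faulhaber's formula for \<open>-a\<close>.\<close>
  moreover have "pcong p 1 (G * - of_nat a) (G * of_nat (p - a))"
  proof (rule pcong_mult_left)
    show "pcong p 1 (- of_nat a) (of_nat (p - a))"
      unfolding pcong_def using assms
      by (intro bexI[of _ "- 1"]) (auto simp: of_nat_diff)
  qed (rule G)
  ultimately have "pcong p 1 (- (of_nat a * G)) (- (B * ((- 1) ^ b * of_nat (a + b - 1 choose b))))"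
    by (auto intro: pcong_trans simp: mult.commute)
  from pcong_minus[OF this] show ?thesis by (simp add: G_def B_def mult_ac)
qed

section \<open>Reflection and the binomial transform modulo $p^2$\<close>

lemma sum_reverse_residues: "(\<Sum>j=1..p-1. f j) = (\<Sum>j=1..p-1. f (p - j))"
  using sum.atLeastAtMost_rev[of f 1 "p - 1"] prime_gt_0_nat[OF prime_p] by simp

text \<open>For exponent 1 the two sides differ by \<open>p^2/(j^2 (p - j))\<close>; the general case is the power of
  this, expanded to first order in \<open>p\<close>.\<close>
lemma inverse_power_reflect:
  assumes "j \<in> {1..p - 1}"
  shows "pcong p 2 (1 / of_nat (p - j) ^ a)
           ((- 1) ^ a * (1 / of_nat j ^ a + of_nat a * of_nat p / of_nat j ^ (a + 1)))"
proof (induction a)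
  case (Suc a)
  define x where "x = (1 / of_nat j :: rat)"
  have "p - j \<in> {1..p - 1}" using assms by auto
  then have nd: "\<not> p dvd j" "\<not> p dvd p - j" using assms not_dvd_residue by blast+
  have x: "x \<in> p_integral p" unfolding x_def by (intro p_integral_divide nd) auto
  have pow: "c / of_nat j ^ k = c * x ^ k" for c :: rat and k
    by (simp add: x_def power_one_over)
  have base: "pcong p 2 (1 / of_nat (p - j)) (- (x + of_nat p * x ^ 2))"
    unfolding pcong_def
  proof (rule bexI)
    have "(of_nat j :: rat) \<noteq> 0" "(of_nat p - of_nat j :: rat) \<noteq> 0" using assms by auto
    then show "1 / of_nat (p - j) - (- (x + of_nat p * x ^ 2)) = of_nat p ^ 2 * (x ^ 2 / of_nat (p - j))"
      unfolding x_def using assms by (simp add: of_nat_diff divide_simps) (simp add: algebra_simps power2_eq_square)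
    show "x ^ 2 / of_nat (p - j) \<in> p_integral p"
      by (intro p_integral_divide nd p_integral_power x)
  qed
  let ?f = "\<lambda>a. (- 1) ^ a * (x ^ a + of_nat a * of_nat p * x ^ (a + 1))"
  have "pcong p 2 (1 / of_nat (p - j) * (1 / of_nat (p - j) ^ a)) (- (x + of_nat p * x ^ 2) * ?f a)"
    using Suc.IH nd x unfolding pow
    by (intro pcong_mult base p_integral_divide p_integral_mult p_integral_add p_integral_power) auto
  also have "pcong p 2 \<dots> (?f (Suc a))"
    unfolding pcong_def
  proof (rule bexI)
    show "- (x + of_nat p * x ^ 2) * ?f a - ?f (Suc a)
        = of_nat p ^ 2 * ((- 1) ^ Suc a * of_nat a * x ^ (a + 3))"
      by (simp add: algebra_simps power2_eq_square power3_eq_cube power_add)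
    show "(- 1) ^ Suc a * of_nat a * x ^ (a + 3) \<in> p_integral p"
      by (intro p_integral_mult p_integral_power p_integral_minus p_integral_1 p_integral_of_nat x)
  qed
  finally show ?case unfolding pow by simp
qed auto

text \<open>Wolstenholme's congruence: reflection shows \<open>2 H_n = - p H_n(2)\<close> modulo \<open>p^2\<close>, and \<open>H_n(2)\<close>
  is divisible by \<open>p\<close>.\<close>
lemma gen_harm_1_pcong_0:
  assumes "p \<ge> 5"
  shows "pcong p 2 (gen_harm 1 (p - 1)) 0"
proof -
  have "pcong p 2 (\<Sum>j=1..p-1. 1 / of_nat (p - j) ^ 1)
      (\<Sum>j=1..p-1. (- 1) ^ 1 * (1 / of_nat j ^ 1 + of_nat 1 * of_nat p / of_nat j ^ (1 + 1)))"
    by (intro pcong_sum inverse_power_reflect)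
  moreover have "gen_harm 1 (p - 1) = (\<Sum>j=1..p-1. 1 / of_nat (p - j) ^ 1)"
    unfolding gen_harm_def by (rule sum_reverse_residues)
  moreover have "(\<Sum>j=1..p-1. (- 1) ^ 1 * (1 / of_nat j ^ 1 + of_nat 1 * of_nat p / of_nat j ^ (1 + 1)))
      = - (gen_harm 1 (p - 1) + of_nat p * gen_harm 2 (p - 1))"
    by (simp add: gen_harm_def sum.distrib sum_negf sum_subtractf sum_distrib_left power2_eq_square)
  ultimately have "pcong p 2 (gen_harm 1 (p - 1)) (- (gen_harm 1 (p - 1) + of_nat p * gen_harm 2 (p - 1)))"
    by (simp only:)
  also have "pcong p 2 \<dots> (- (gen_harm 1 (p - 1) + of_nat p * 0))"
    using pcong_mult_p[OF gen_harm_pcong_0[of 2]] assms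
    by (intro pcong_minus pcong_add pcong_refl) (auto simp: numeral_2_eq_2)
  finally have "pcong p 2 (gen_harm 1 (p - 1) + gen_harm 1 (p - 1))
      (- (gen_harm 1 (p - 1) + of_nat p * 0) + gen_harm 1 (p - 1))"
    by (intro pcong_add pcong_refl)
  then have "pcong p 2 (of_nat 2 * gen_harm 1 (p - 1)) (of_nat 2 * 0)" by simp
  then show ?thesis by (rule pcong_cancel) (use assms in \<open>auto dest: dvd_imp_le\<close>)
qed

text \<open>\<open>H_(p-j)\<close> is \<open>H_n\<close>, which vanishes, minus the \<open>j - 1\<close> terms \<open>1/(p - i)\<close> with \<open>i < j\<close>.\<close>
lemma gen_harm_1_reflect:
  assumes "p \<ge> 5" "j \<in> {1..p - 1}"
  shows "pcong p 2 (gen_harm 1 (p - j)) (gen_harm 1 (j - 1) + of_nat p * gen_harm 2 (j - 1))"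
  using assms(2)
proof (induction j)
  case (Suc j)
  show ?case
  proof (cases "j = 0")
    case True
    then show ?thesis using gen_harm_1_pcong_0[OF assms(1)] by (simp add: gen_harm_def)
  next
    case False
    then have j: "j \<in> {1..p - 1}" using Suc.prems by auto
    have eq: "gen_harm 1 (p - Suc j) = gen_harm 1 (p - j) - 1 / of_nat (p - j) ^ 1"
      using gen_harm_Suc[of 1 "p - Suc j"] Suc.prems by (simp add: Suc_diff_Suc)
    have eq2: "gen_harm a j = gen_harm a (j - 1) + 1 / of_nat j ^ a" for a
      using gen_harm_Suc[of a "j - 1"] False by simp
    have "pcong p 2 (gen_harm 1 (p - Suc j)) (gen_harm 1 (j - 1) + of_nat p * gen_harm 2 (j - 1) -
        (- 1) ^ 1 * (1 / of_nat j ^ 1 + of_nat 1 * of_nat p / of_nat j ^ (1 + 1)))"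
      unfolding eq using j by (intro pcong_diff Suc.IH inverse_power_reflect)
    then show ?thesis by (simp add: eq2 algebra_simps numeral_2_eq_2)
  qed
qed simp

text \<open>The left-hand side is the product of \<open>1 - p/i\<close> over \<open>1 \<le> i \<le> k\<close>.\<close>
lemma alternating_choose_pcong:
  assumes "k \<le> p - 1"
  shows "pcong p 2 ((- 1) ^ k * of_nat (p - 1 choose k)) (1 - of_nat p * gen_harm 1 k)"
  using assms
proof (induction k)
  case (Suc k)
  define x where "x = (1 / of_nat (Suc k) :: rat)"
  have nd: "\<not> p dvd Suc k" using Suc.prems not_dvd_residue by simp
  have x: "x \<in> p_integral p" unfolding x_def by (intro p_integral_divide nd) auto
  have "Suc k * (p - 1 choose Suc k) = (p - 1 - k) * (p - 1 choose k)"
    by (metis binomial_absorb_comp binomial_absorption diff_Suc_1)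
  then have "(of_nat (Suc k) * of_nat (p - 1 choose Suc k) :: rat)
      = of_nat (p - 1 - k) * of_nat (p - 1 choose k)"
    by (metis of_nat_mult)
  moreover have "(of_nat (p - 1 - k) :: rat) = of_nat p - of_nat (Suc k)"
    using Suc.prems by (simp add: of_nat_diff)
  ultimately have D: "of_nat (p - 1 choose Suc k) = (of_nat p * x - 1) * of_nat (p - 1 choose k)"
    unfolding x_def by (simp add: field_simps del: of_nat_Suc)
  have "(- 1) ^ Suc k * of_nat (p - 1 choose Suc k)
      = (1 - of_nat p * x) * ((- 1) ^ k * of_nat (p - 1 choose k))"
    unfolding D by (simp add: algebra_simps)
  also have "pcong p 2 \<dots> ((1 - of_nat p * x) * (1 - of_nat p * gen_harm 1 k))"
    using Suc x by (intro pcong_mult_left) auto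
  also have "pcong p 2 \<dots> (1 - of_nat p * gen_harm 1 (Suc k))"
    unfolding pcong_def
  proof (rule bexI)
    show "(1 - of_nat p * x) * (1 - of_nat p * gen_harm 1 k) - (1 - of_nat p * gen_harm 1 (Suc k))
        = of_nat p ^ 2 * (x * gen_harm 1 k)"
      by (simp add: gen_harm_Suc x_def algebra_simps power2_eq_square)
    show "x * gen_harm 1 k \<in> p_integral p"
      using Suc.prems x by (intro p_integral_mult gen_harm_p_integral) auto
  qed
  finally show ?case .
qed (auto simp: gen_harm_def)

lemma alt_binomial_sum_pcong:
  assumes "\<And>k. k \<in> {1..p - 1} \<Longrightarrow> f k \<in> p_integral p"
  shows "pcong p 2 (alt_binomial_sum f (p - 1))
           (of_nat p * (\<Sum>k=1..p-1. gen_harm 1 k * f k) - (\<Sum>k=1..p-1. f k))"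
proof -
  have "pcong p 2 (alt_binomial_sum f (p - 1)) (\<Sum>k=1..p-1. f k * - (1 - of_nat p * gen_harm 1 k))"
    unfolding alt_binomial_sum_def
  proof (rule pcong_sum)
    fix k assume k: "k \<in> {1..p-1}"
    then have "pcong p 2 (f k * - ((- 1) ^ k * of_nat (p - 1 choose k)))
        (f k * - (1 - of_nat p * gen_harm 1 k))"
      using assms by (intro pcong_mult_left pcong_minus alternating_choose_pcong) auto
    moreover have "(- 1) ^ (k - 1) = (- ((- 1) ^ k) :: rat)" using k by (cases k) auto
    ultimately show "pcong p 2 ((- 1) ^ (k - 1) * of_nat (p - 1 choose k) * f k)
        (f k * - (1 - of_nat p * gen_harm 1 k))" by (simp add: mult_ac)
  qed
  then show ?thesis by (simp add: algebra_simps sum_subtractf sum_distrib_left)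
qed

section \<open>Evaluation of the harmonic sums\<close>

text \<open>Replace \<open>j\<close> by \<open>p - j\<close> and expand the summand to first order in \<open>p\<close>; the reflected inner sum
  stops before \<open>j\<close>, which is why diagonal sums are subtracted.\<close>
lemma double_harm_1_3_reflect:
  assumes "p \<ge> 5"
  shows "pcong p 2 (double_harm 1 3 (p - 1))
    (- (double_harm 1 3 (p - 1) - gen_harm 4 (p - 1))
     - of_nat p * (double_harm 2 3 (p - 1) - gen_harm 5 (p - 1))
     - 3 * of_nat p * (double_harm 1 4 (p - 1) - gen_harm 5 (p - 1)))"
proof -
  have "pcong p 2 (\<Sum>j=1..p-1. gen_harm 1 (p - j) / of_nat (p - j) ^ 3)
     (\<Sum>j=1..p-1. - (gen_harm 1 (j - 1) / of_nat j ^ 3) - of_nat p * (gen_harm 2 (j - 1) / of_nat j ^ 3)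
        - 3 * of_nat p * (gen_harm 1 (j - 1) / of_nat j ^ 4))"
  proof (rule pcong_sum)
    fix j assume j: "j \<in> {1..p - 1}"
    define x where "x = (1 / of_nat j :: rat)"
    have x: "x \<in> p_integral p"
      unfolding x_def using j by (intro p_integral_divide not_dvd_residue) auto
    have pow: "c / of_nat j ^ k = c * x ^ k" for c :: rat and k
      by (simp add: x_def power_one_over)
    define h g where "h = gen_harm 1 (j - 1)" and "g = gen_harm 2 (j - 1)"
    have hg: "h \<in> p_integral p" "g \<in> p_integral p" "gen_harm 1 (p - j) \<in> p_integral p"
      unfolding h_def g_def using j by auto
    have "pcong p 2 (gen_harm 1 (p - j) * (1 / of_nat (p - j) ^ 3))
        ((h + of_nat p * g) * ((- 1) ^ 3 * (1 / of_nat j ^ 3 + of_nat 3 * of_nat p / of_nat j ^ (3 + 1))))"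
      unfolding h_def g_def using x hg unfolding pow h_def g_def
      by (intro pcong_mult gen_harm_1_reflect[OF assms j] inverse_power_reflect[OF j, unfolded pow]) auto
    also have "pcong p 2 \<dots> (- (h * x ^ 3) - of_nat p * (g * x ^ 3) - 3 * of_nat p * (h * x ^ 4))"
      unfolding pcong_def
    proof (rule bexI)
      show "(h + of_nat p * g) * ((- 1) ^ 3 * (1 / of_nat j ^ 3 + of_nat 3 * of_nat p / of_nat j ^ (3 + 1)))
          - (- (h * x ^ 3) - of_nat p * (g * x ^ 3) - 3 * of_nat p * (h * x ^ 4))
          = of_nat p ^ 2 * (- 3 * g * x ^ 4)"
        unfolding pow by (simp add: algebra_simps power2_eq_square)
    qed (use x hg in auto)
    finally show "pcong p 2 (gen_harm 1 (p - j) / of_nat (p - j) ^ 3)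
       (- (gen_harm 1 (j - 1) / of_nat j ^ 3) - of_nat p * (gen_harm 2 (j - 1) / of_nat j ^ 3)
        - 3 * of_nat p * (gen_harm 1 (j - 1) / of_nat j ^ 4))"
      by (simp add: pow h_def g_def)
  qed
  also have "(\<Sum>j=1..p-1. - (gen_harm 1 (j - 1) / of_nat j ^ 3) - of_nat p * (gen_harm 2 (j - 1) / of_nat j ^ 3)
        - 3 * of_nat p * (gen_harm 1 (j - 1) / of_nat j ^ 4))
      = - (double_harm 1 3 (p - 1) - gen_harm (1 + 3) (p - 1))
        - of_nat p * (double_harm 2 3 (p - 1) - gen_harm (2 + 3) (p - 1))
        - 3 * of_nat p * (double_harm 1 4 (p - 1) - gen_harm (1 + 4) (p - 1))"
    unfolding strict_double_harm[symmetric] sum_distrib_left sum_subtractf sum_negf ..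
  finally show ?thesis
    unfolding double_harm_def[of 1 3] sum_reverse_residues[of "\<lambda>j. gen_harm 1 j / of_nat j ^ 3"]
    by simp
qed

lemma sum_harm_square_reflect:
  assumes "p \<ge> 5"
  shows "pcong p 1 (\<Sum>k=1..p-1. gen_harm 1 k ^ 2 / of_nat k ^ 3)
           (- (\<Sum>k=1..p-1. gen_harm 1 (k - 1) ^ 2 / of_nat k ^ 3))"
proof -
  have "pcong p 1 (\<Sum>k=1..p-1. gen_harm 1 (p - k) ^ 2 / of_nat (p - k) ^ 3)
      (\<Sum>k=1..p-1. - (gen_harm 1 (k - 1) ^ 2 / of_nat k ^ 3))"
  proof (rule pcong_sum)
    fix j assume j: "j \<in> {1..p - 1}"
    have h: "gen_harm 1 (j - 1) \<in> p_integral p" "gen_harm 2 (j - 1) \<in> p_integral p"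
      "gen_harm 1 (p - j) \<in> p_integral p" using j by auto
    have x: "1 / of_nat j ^ k \<in> p_integral p" for k
      using j by (intro p_integral_divide_power not_dvd_residue) auto
    have "pcong p 1 (gen_harm 1 (p - j)) (gen_harm 1 (j - 1) + of_nat p ^ 1 * gen_harm 2 (j - 1))"
      using pcong_weaken[OF gen_harm_1_reflect[OF assms j], of 1] by simp
    also have "pcong p 1 \<dots> (gen_harm 1 (j - 1) + 0)"
      by (intro pcong_add pcong_refl pcong_p_power_mult h)
    finally have 1: "pcong p 1 (gen_harm 1 (p - j)) (gen_harm 1 (j - 1))" by simp
    have "pcong p 1 (1 / of_nat (p - j) ^ 3) (- (1 / of_nat j ^ 3) + of_nat p ^ 1 * (- 3 * (1 / of_nat j ^ 4)))"
      using pcong_weaken[OF inverse_power_reflect[OF j, of 3], of 1] by (simp add: algebra_simps)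
    also have "pcong p 1 \<dots> (- (1 / of_nat j ^ 3) + 0)"
      by (intro pcong_add pcong_refl pcong_p_power_mult p_integral_mult p_integral_minus
          p_integral_numeral x)
    finally have 2: "pcong p 1 (1 / of_nat (p - j) ^ 3) (- (1 / of_nat j ^ 3))" by simp
    have "pcong p 1 (gen_harm 1 (p - j) ^ 2 * (1 / of_nat (p - j) ^ 3))
        (gen_harm 1 (j - 1) ^ 2 * - (1 / of_nat j ^ 3))"
      using 1 2 h x by (intro pcong_mult pcong_power) auto
    then show "pcong p 1 (gen_harm 1 (p - j) ^ 2 / of_nat (p - j) ^ 3)
        (- (gen_harm 1 (j - 1) ^ 2 / of_nat j ^ 3))" by simp
  qed
  then show ?thesis
    unfolding sum_reverse_residues[of "\<lambda>k. gen_harm 1 k ^ 2 / of_nat k ^ 3"] by (simp add: sum_negf)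
qed

lemma double_harm_p_integral [intro]: "n < p \<Longrightarrow> double_harm a b n \<in> p_integral p"
  unfolding double_harm_def
  by (intro p_integral_sum p_integral_divide_power gen_harm_p_integral not_dvd_residue) auto

text \<open>The first two are instances of \<open>strict_double_harm_pcong\<close>, whose diagonal correction \<open>H_n(5)\<close>
  vanishes modulo \<open>p\<close>; the third follows from the second since \<open>D(2,3) + D(3,2)\<close> vanishes.\<close>
lemma double_harm_weight_5:
  assumes "p \<ge> 7"
  shows "pcong p 1 (double_harm 1 4 (p - 1)) (bernoulli (p - 5))"
    and "pcong p 1 (double_harm 2 3 (p - 1)) (- 2 * bernoulli (p - 5))"
    and "pcong p 1 (double_harm 3 2 (p - 1)) (2 * bernoulli (p - 5))"
proof -
  have P5: "pcong p 1 (gen_harm 5 (p - 1)) 0"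
    using assms by (intro gen_harm_pcong_0) auto
  have "pcong p 1 (double_harm 1 4 (p - 1) - gen_harm 5 (p - 1)) (bernoulli (p - 5))"
    using strict_double_harm_pcong[of 1 4] assms unfolding strict_double_harm by simp
  from pcong_add[OF this P5]
  show D14: "pcong p 1 (double_harm 1 4 (p - 1)) (bernoulli (p - 5))" by simp
  have "4 choose 3 = (4 :: nat)" by (simp add: eval_nat_numeral)
  then have "pcong p 1 (of_nat 2 * (double_harm 2 3 (p - 1) - gen_harm 5 (p - 1)))
      (of_nat 2 * (- 2 * bernoulli (p - 5)))"
    using strict_double_harm_pcong[of 2 3] assms unfolding strict_double_harm by simp
  then have "pcong p 1 (double_harm 2 3 (p - 1) - gen_harm 5 (p - 1)) (- 2 * bernoulli (p - 5))"
    by (rule pcong_cancel) (use assms in \<open>auto dest: dvd_imp_le\<close>)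
  from pcong_add[OF this P5]
  show D23: "pcong p 1 (double_harm 2 3 (p - 1)) (- 2 * bernoulli (p - 5))" by simp
  have stuffle: "double_harm 3 2 (p - 1)
      = gen_harm 3 (p - 1) * gen_harm 2 (p - 1) + gen_harm 5 (p - 1) - double_harm 2 3 (p - 1)"
    using double_harm_stuffle[of 3 2 "p - 1"] by simp
  have "pcong p 1 (gen_harm 3 (p - 1) * gen_harm 2 (p - 1)) (gen_harm 3 (p - 1) * 0)"
    using assms by (intro pcong_mult_left gen_harm_pcong_0) auto
  from pcong_diff[OF pcong_add[OF this P5] D23]
  show "pcong p 1 (double_harm 3 2 (p - 1)) (2 * bernoulli (p - 5))"
    unfolding stuffle by simp
qed

text \<open>The transform of \<open>1/k^4\<close> is \<open>h_4\<close>, all of whose terms except \<open>H_n(4)/4\<close> are divisible by \<open>p^2\<close>. Modulo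
  \<open>p^2\<close> it is also \<open>p D(1,4) - H_n(4)\<close>, so \<open>5/4 H_n(4) = p D(1,4)\<close>.\<close>
lemma gen_harm_4_pcong:
  assumes "p \<ge> 7"
  shows "pcong p 2 (5 * gen_harm 4 (p - 1)) (4 * of_nat p * bernoulli (p - 5))"
proof -
  let ?n = "p - 1"
  obtain z where z: "z \<in> p_integral p" "gen_harm 1 ?n = of_nat p ^ 2 * z"
    using gen_harm_1_pcong_0 assms unfolding pcong_def by auto
  obtain y where y: "y \<in> p_integral p" "gen_harm 2 ?n = of_nat p * y"
    using gen_harm_pcong_0[of 2] assms unfolding pcong_def by auto
  obtain w where w: "w \<in> p_integral p" "double_harm 1 4 ?n - bernoulli (p - 5) = of_nat p * w"
    using double_harm_weight_5(1)[OF assms] unfolding pcong_def by auto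
  have "pcong p 2 (alt_binomial_sum (\<lambda>k. 1 / of_nat k ^ 4) ?n)
      (of_nat p * (\<Sum>k=1..?n. gen_harm 1 k * (1 / of_nat k ^ 4)) - (\<Sum>k=1..?n. 1 / of_nat k ^ 4))"
    by (intro alt_binomial_sum_pcong p_integral_divide_power not_dvd_residue) auto
  then obtain u where u: "u \<in> p_integral p"
    "alt_binomial_sum (\<lambda>k. 1 / of_nat k ^ 4) ?n
      - (of_nat p * double_harm 1 4 ?n - gen_harm 4 ?n) = of_nat p ^ 2 * u"
    unfolding pcong_def by (auto simp: double_harm_def gen_harm_def)
  have eq: "24 * alt_binomial_sum (\<lambda>k. 1 / of_nat k ^ 4) ?n
      = gen_harm 1 ?n ^ 4 + 6 * gen_harm 1 ?n ^ 2 * gen_harm 2 ?n + 3 * gen_harm 2 ?n ^ 2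
         + 8 * gen_harm 1 ?n * gen_harm 3 ?n + 6 * gen_harm 4 ?n"
    by (simp add: alt_binomial_sum_reciprocal_powers)
  \<comment> \<open>\<open>p^2 v\<close> collects the terms of \<open>24 h_4\<close> other than \<open>6 H_n(4)\<close>.\<close>
  define v where "v = gen_harm 1 ?n ^ 3 * z + 6 * gen_harm 1 ?n * z * gen_harm 2 ?n + 3 * y ^ 2 + 8 * z * gen_harm 3 ?n"
  have v: "v \<in> p_integral p"
    unfolding v_def using z y assms
    by (intro p_integral_add p_integral_mult p_integral_power gen_harm_p_integral) auto
  have "gen_harm 1 ?n ^ 4 + 6 * gen_harm 1 ?n ^ 2 * gen_harm 2 ?n + 3 * gen_harm 2 ?n ^ 2
         + 8 * gen_harm 1 ?n * gen_harm 3 ?n = of_nat p ^ 2 * v"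
    unfolding v_def z(2) y(2) by (simp add: algebra_simps eval_nat_numeral)
  with eq have "24 * alt_binomial_sum (\<lambda>k. 1 / of_nat k ^ 4) ?n = of_nat p ^ 2 * v + 6 * gen_harm 4 ?n"
    by simp
  moreover have "of_nat p * double_harm 1 4 ?n = of_nat p * bernoulli (p - 5) + of_nat p ^ 2 * w"
    using w(2) by (simp add: algebra_simps power2_eq_square)
  ultimately have "of_nat 6 * (5 * gen_harm 4 ?n) - of_nat 6 * (4 * of_nat p * bernoulli (p - 5))
      = of_nat p ^ 2 * (24 * (u + w) - v)"
    using u(2) by (simp add: algebra_simps)
  then have "pcong p 2 (of_nat 6 * (5 * gen_harm 4 ?n)) (of_nat 6 * (4 * of_nat p * bernoulli (p - 5)))"
    unfolding pcong_def using u w v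
    by (intro bexI[of _ "24 * (u + w) - v"]) auto
  then show ?thesis
    by (rule pcong_cancel) (use assms in \<open>auto dest: dvd_imp_le\<close>)
qed

text \<open>Reflection gives \<open>2 D(1,3) = H_n(4) - p (D(2,3) + 3 D(1,4))\<close>, that is
  \<open>(4/5 + 2 - 3) p B\<close>.\<close>
lemma double_harm_1_3_pcong:
  assumes "p \<ge> 7"
  shows "pcong p 2 (10 * double_harm 1 3 (p - 1)) (- of_nat p * bernoulli (p - 5))"
proof -
  let ?n = "p - 1"
  obtain a where a: "a \<in> p_integral p" "double_harm 1 4 ?n - bernoulli (p - 5) = of_nat p * a"
    using double_harm_weight_5(1)[OF assms] unfolding pcong_def by auto
  obtain b where b: "b \<in> p_integral p" "double_harm 2 3 ?n - (- 2 * bernoulli (p - 5)) = of_nat p * b"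
    using double_harm_weight_5(2)[OF assms] unfolding pcong_def by auto
  obtain c where c: "c \<in> p_integral p" "gen_harm 5 ?n = of_nat p * c"
    using gen_harm_pcong_0[of 5] assms unfolding pcong_def by auto
  obtain d where d: "d \<in> p_integral p"
    "5 * gen_harm 4 ?n - 4 * of_nat p * bernoulli (p - 5) = of_nat p ^ 2 * d"
    using gen_harm_4_pcong[OF assms] unfolding pcong_def by auto
  obtain e where e: "e \<in> p_integral p"
    "double_harm 1 3 ?n - (- (double_harm 1 3 ?n - gen_harm 4 ?n)
     - of_nat p * (double_harm 2 3 ?n - gen_harm 5 ?n)
     - 3 * of_nat p * (double_harm 1 4 ?n - gen_harm 5 ?n)) = of_nat p ^ 2 * e"
    using double_harm_1_3_reflect assms unfolding pcong_def by auto
  \<comment> \<open>The coefficients eliminate everything but the wanted sum and \<open>p B\<close>; each bracket is a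
    multiple of \<open>p\<close> or \<open>p^2\<close> by one of the relations just obtained.\<close>
  have "10 * double_harm 1 3 ?n - (- of_nat p * bernoulli (p - 5))
      = 5 * (double_harm 1 3 ?n - (- (double_harm 1 3 ?n - gen_harm 4 ?n)
             - of_nat p * (double_harm 2 3 ?n - gen_harm 5 ?n)
             - 3 * of_nat p * (double_harm 1 4 ?n - gen_harm 5 ?n)))
        + (5 * gen_harm 4 ?n - 4 * of_nat p * bernoulli (p - 5))
        - 5 * of_nat p * (double_harm 2 3 ?n - (- 2 * bernoulli (p - 5)))
        - 15 * of_nat p * (double_harm 1 4 ?n - bernoulli (p - 5)) + 20 * of_nat p * gen_harm 5 ?n"
    by (simp add: algebra_simps)
  also have "\<dots> = of_nat p ^ 2 * (5 * e + d - 5 * b - 15 * a + 20 * c)"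
    unfolding e(2) unfolding a(2) b(2) c(2) d(2) by (simp add: algebra_simps power2_eq_square)
  finally show ?thesis
    unfolding pcong_def using a(1) b(1) c(1) d(1) e(1)
    by (intro bexI[of _ "5 * e + d - 5 * b - 15 * a + 20 * c"]) (auto intro!: p_integral_intros)
qed

text \<open>All congruences are modulo \<open>p\<close>. By parts, twice the sum is \<open>D(3,2)\<close> minus the sum \<open>V\<close> of \<open>H_(k-1)^2/k^3\<close>. With \<open>W\<close> the sum of
  \<open>H_k^2/k^3\<close>, expanding \<open>H_(k-1) = H_k - 1/k\<close> gives \<open>V = W - 2 D(1,4)\<close> and reflection gives
  \<open>W = -V\<close>; hence \<open>V = - D(1,4)\<close>.\<close>
lemma sum_harm_gen_harm_3_pcong:
  assumes "p \<ge> 7"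
  shows "pcong p 1 (2 * (\<Sum>k=1..p-1. gen_harm 1 k * (gen_harm 3 k / of_nat k))) (3 * bernoulli (p - 5))"
proof -
  let ?n = "p - 1"
  define W where "W = (\<Sum>k=1..?n. gen_harm 1 k ^ 2 / of_nat k ^ 3)"
  obtain a where a: "a \<in> p_integral p" "double_harm 1 4 ?n - bernoulli (p - 5) = of_nat p * a"
    using double_harm_weight_5(1)[OF assms] unfolding pcong_def by auto
  obtain b where b: "b \<in> p_integral p" "double_harm 3 2 ?n - 2 * bernoulli (p - 5) = of_nat p * b"
    using double_harm_weight_5(3)[OF assms] unfolding pcong_def by auto
  obtain c where c: "c \<in> p_integral p" "gen_harm 5 ?n = of_nat p * c"
    using gen_harm_pcong_0[of 5] assms unfolding pcong_def by auto
  obtain d where d: "d \<in> p_integral p" "gen_harm 3 ?n = of_nat p * d"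
    using gen_harm_pcong_0[of 3] assms unfolding pcong_def by auto
  obtain e where e: "e \<in> p_integral p"
    "W - (- (W - 2 * double_harm 1 4 ?n + gen_harm 5 ?n)) = of_nat p * e"
    using sum_harm_square_reflect assms
    unfolding pcong_def sum_harm_square_pred W_def[symmetric] by auto
  define Q where "Q = (\<Sum>k=1..?n. gen_harm 1 k * (gen_harm 3 k / of_nat k))"
  have Q: "2 * Q = gen_harm 1 ?n ^ 2 * gen_harm 3 ?n - (W - 2 * double_harm 1 4 ?n + gen_harm 5 ?n)
      + double_harm 3 2 ?n"
    unfolding Q_def sum_harm_cubic_by_parts sum_harm_square_pred W_def ..
  have "of_nat 2 * (2 * Q) - of_nat 2 * (3 * bernoulli (p - 5))
      = 2 * (gen_harm 1 ?n ^ 2 * gen_harm 3 ?n) - (W - (- (W - 2 * double_harm 1 4 ?n + gen_harm 5 ?n)))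
        + 2 * (double_harm 1 4 ?n - bernoulli (p - 5)) - gen_harm 5 ?n
        + 2 * (double_harm 3 2 ?n - 2 * bernoulli (p - 5))"
    unfolding Q by (simp add: algebra_simps)
  also have "\<dots> = of_nat p ^ 1 * (2 * gen_harm 1 ?n ^ 2 * d - e + 2 * a - c + 2 * b)"
    unfolding e(2) unfolding a(2) b(2) c(2) d(2) by (simp add: algebra_simps)
  finally have "pcong p 1 (of_nat 2 * (2 * Q)) (of_nat 2 * (3 * bernoulli (p - 5)))"
    unfolding pcong_def using a(1) b(1) c(1) d(1) e(1) assms
    by (intro bexI[of _ "2 * gen_harm 1 ?n ^ 2 * d - e + 2 * a - c + 2 * b"]) (auto intro!: p_integral_intros)
  then show ?thesis
    unfolding Q_def
    by (rule pcong_cancel) (use assms in \<open>auto dest: dvd_imp_le\<close>)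
qed

text \<open>Let \<open>Q\<close> be the sum of \<open>H_k H_k(3)/k\<close>. Evaluating the transform of \<open>H_k(3)/k\<close> in two ways yields
  \<open>A + D(2,2) = 2 (p Q - D(3,1))\<close>, where \<open>2 D(2,2) = H_n(4)\<close> and \<open>D(3,1) = H_n(4) - D(1,3)\<close> by
  the product formula \<open>double_harm_stuffle\<close>.\<close>
lemma sum_harm_square_pcong:
  assumes "p \<ge> 7"
  shows "pcong p 2 (5 * (\<Sum>k=1..p-1. gen_harm 1 k ^ 2 / of_nat k ^ 2)) (4 * of_nat p * bernoulli (p - 5))"
proof -
  let ?n = "p - 1"
  define A where "A = (\<Sum>k=1..?n. gen_harm 1 k ^ 2 / of_nat k ^ 2)"
  define Q where "Q = (\<Sum>k=1..?n. gen_harm 1 k * (gen_harm 3 k / of_nat k))"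
  have p3: "gen_harm 3 k / of_nat k \<in> p_integral p" if "k \<in> {1..?n}" for k
    using that by (intro p_integral_divide gen_harm_p_integral not_dvd_residue) auto
  have "2 * (\<Sum>m=1..?n. (gen_harm 1 m ^ 2 + gen_harm 2 m) / (2 * of_nat m ^ 2)) = A + double_harm 2 2 ?n"
    by (simp add: A_def double_harm_def sum_distrib_left add_divide_distrib sum.distrib)
  moreover obtain a where a: "a \<in> p_integral p"
    "alt_binomial_sum (\<lambda>k. gen_harm 3 k / of_nat k) ?n - (of_nat p * Q - double_harm 3 1 ?n) = of_nat p ^ 2 * a"
    using alt_binomial_sum_pcong[of "\<lambda>k. gen_harm 3 k / of_nat k", OF p3] unfolding pcong_def by (auto simp: Q_def double_harm_def)
  ultimately have 1: "A + double_harm 2 2 ?n - 2 * (of_nat p * Q - double_harm 3 1 ?n) = of_nat p ^ 2 * (2 * a)"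
    unfolding alt_binomial_sum_gen_harm_3 by (simp add: algebra_simps)
  obtain b where b: "b \<in> p_integral p" "2 * Q - 3 * bernoulli (p - 5) = of_nat p * b"
    using sum_harm_gen_harm_3_pcong[OF assms] unfolding pcong_def by (auto simp: Q_def)
  obtain c where c: "c \<in> p_integral p" "10 * double_harm 1 3 ?n - (- of_nat p * bernoulli (p - 5)) = of_nat p ^ 2 * c"
    using double_harm_1_3_pcong[OF assms] unfolding pcong_def by auto
  obtain d where d: "d \<in> p_integral p"
    "5 * gen_harm 4 ?n - 4 * of_nat p * bernoulli (p - 5) = of_nat p ^ 2 * d"
    using gen_harm_4_pcong[OF assms] unfolding pcong_def by auto
  obtain y where y: "y \<in> p_integral p" "gen_harm 2 ?n = of_nat p * y"
    using gen_harm_pcong_0[of 2] assms unfolding pcong_def by auto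
  obtain z where z: "z \<in> p_integral p" "gen_harm 1 ?n = of_nat p ^ 2 * z"
    using gen_harm_1_pcong_0 assms unfolding pcong_def by auto
  have 2: "2 * double_harm 2 2 ?n = gen_harm 2 ?n ^ 2 + gen_harm 4 ?n"
    using double_harm_stuffle[of 2 2 ?n] by (simp add: power2_eq_square)
  have 3: "double_harm 1 3 ?n + double_harm 3 1 ?n = gen_harm 1 ?n * gen_harm 3 ?n + gen_harm 4 ?n"
    using double_harm_stuffle[of 1 3 ?n] by simp
  define w where "w = 20 * a + 10 * b - 5 * y ^ 2 - 5 * d - 20 * z * gen_harm 3 ?n + 2 * c"
  have w: "w \<in> p_integral p"
    unfolding w_def using a(1) b(1) c(1) d(1) y(1) z(1) assms by (auto intro!: p_integral_intros)
  \<comment> \<open>All sums other than \<open>A\<close> cancel; the brackets are the relations collected above.\<close>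
  have "of_nat 2 * (5 * A) - of_nat 2 * (4 * of_nat p * bernoulli (p - 5))
      = 10 * (A + double_harm 2 2 ?n - 2 * (of_nat p * Q - double_harm 3 1 ?n))
        - 5 * (2 * double_harm 2 2 ?n) + 10 * of_nat p * (2 * Q - 3 * bernoulli (p - 5))
        - 20 * (double_harm 1 3 ?n + double_harm 3 1 ?n)
        + 2 * (10 * double_harm 1 3 ?n - (- of_nat p * bernoulli (p - 5)))
        + 25 * gen_harm 4 ?n - 5 * (5 * gen_harm 4 ?n - 4 * of_nat p * bernoulli (p - 5))"
    by (simp add: algebra_simps)
  also have "\<dots> = of_nat p ^ 2 * w"
    unfolding 1 2 3 b(2) c(2) d(2) w_def unfolding y(2) z(2)
    by (simp add: algebra_simps power2_eq_square)
  finally have "pcong p 2 (of_nat 2 * (5 * A)) (of_nat 2 * (4 * of_nat p * bernoulli (p - 5)))"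
    unfolding pcong_def using w by blast
  then show ?thesis
    unfolding A_def by (rule pcong_cancel) (use assms in \<open>auto dest: dvd_imp_le\<close>)
qed

text \<open>The three values are inserted into the telescoped identity; the factor 20, prime to \<open>p\<close>, clears
  their denominators.\<close>
lemma sum_harm_cube_pcong:
  assumes "p \<ge> 7"
  shows "pcong p 2 (\<Sum>j=1..p-1. gen_harm 1 j ^ 3 / of_nat j) (3 / 2 * of_nat p * bernoulli (p - 5))"
proof -
  let ?n = "p - 1"
  define S where "S = (\<Sum>j=1..?n. gen_harm 1 j ^ 3 / of_nat j)"
  define A where "A = (\<Sum>k=1..?n. gen_harm 1 k ^ 2 / of_nat k ^ 2)"
  obtain a where a: "a \<in> p_integral p" "5 * A - 4 * of_nat p * bernoulli (p - 5) = of_nat p ^ 2 * a"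
    using sum_harm_square_pcong[OF assms] unfolding pcong_def A_def by auto
  obtain c where c: "c \<in> p_integral p" "10 * double_harm 1 3 ?n - (- of_nat p * bernoulli (p - 5)) = of_nat p ^ 2 * c"
    using double_harm_1_3_pcong[OF assms] unfolding pcong_def by auto
  obtain d where d: "d \<in> p_integral p"
    "5 * gen_harm 4 ?n - 4 * of_nat p * bernoulli (p - 5) = of_nat p ^ 2 * d"
    using gen_harm_4_pcong[OF assms] unfolding pcong_def by auto
  obtain z where z: "z \<in> p_integral p" "gen_harm 1 ?n = of_nat p ^ 2 * z"
    using gen_harm_1_pcong_0 assms unfolding pcong_def by auto
  have "4 * S = gen_harm 1 ?n ^ 4 + 6 * A - 4 * double_harm 1 3 ?n + gen_harm 4 ?n"
    unfolding S_def A_def by (rule sum_harm_cube_telescope)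
  then have "of_nat 20 * S - of_nat 20 * (3 / 2 * of_nat p * bernoulli (p - 5))
      = 5 * (gen_harm 1 ?n ^ 3 * gen_harm 1 ?n) + 6 * (5 * A - 4 * of_nat p * bernoulli (p - 5))
        - 2 * (10 * double_harm 1 3 ?n - (- of_nat p * bernoulli (p - 5)))
        + (5 * gen_harm 4 ?n - 4 * of_nat p * bernoulli (p - 5))"
    by (simp add: algebra_simps eval_nat_numeral)
  also have "\<dots> = of_nat p ^ 2 * (5 * gen_harm 1 ?n ^ 3 * z + 6 * a - 2 * c + d)"
    unfolding a(2) c(2) d(2) by (subst (2) z(2)) (simp add: algebra_simps)
  finally have "of_nat 20 * S - of_nat 20 * (3 / 2 * of_nat p * bernoulli (p - 5))
      = of_nat p ^ 2 * (5 * gen_harm 1 ?n ^ 3 * z + 6 * a - 2 * c + d)" .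
  moreover have "5 * gen_harm 1 ?n ^ 3 * z + 6 * a - 2 * c + d \<in> p_integral p"
    using a(1) c(1) d(1) z(1) assms by (auto intro!: p_integral_intros)
  ultimately have "pcong p 2 (of_nat 20 * S) (of_nat 20 * (3 / 2 * of_nat p * bernoulli (p - 5)))"
    unfolding pcong_def by blast
  moreover have "\<not> p dvd 20"
  proof
    assume "p dvd 20"
    then have "p dvd 2 * 2 * 5" by simp
    then have "p dvd 2 \<or> p dvd 5" using prime_p prime_dvd_mult_iff by blast
    then show False using assms by (auto dest: dvd_imp_le)
  qed
  ultimately show ?thesis unfolding S_def by (rule pcong_cancel)
qed

end

theorem corollary3p1p1:
  fixes p :: nat
  assumes "prime p" and "p \<ge> 7"
  shows "qcong (\<Sum>j=1..p-1. harm_rat j ^ 3 / of_nat j)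
               (3 / 2 * of_nat p * bernoulli (p - 5)) (int p ^ 2)"
proof -
  have harm: "harm_rat j = gen_harm 1 j" for j
    by (simp add: harm_rat_def gen_harm_def)
  have "(\<Sum>j=1..p-1. gen_harm 1 j ^ 3 / of_nat j) \<in> p_integral p"
    using assms(1)
    by (intro p_integral_sum p_integral_divide p_integral_power gen_harm_p_integral not_dvd_residue) auto
  moreover have "3 / of_nat 2 * of_nat p * bernoulli (p - 5) \<in> p_integral p"
    using assms
    by (intro p_integral_mult p_integral_divide bernoulli_p_integral) (auto dest: dvd_imp_le)
  ultimately show ?thesis
    unfolding harm using assms sum_harm_cube_pcong by (intro qcong_if_pcong) auto
qed

end
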